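(* Let $p\geq 5\cdot 10^{18}$ be a prime, let $\chi$ be a non-principal Dirichlet character modulo $p$, and let $N$ and $H$ be integers with $H\ge 1$ such that $\chi$ is constant on $(N,N+H]$. Then $$H< C\,g(p)\, p^{1/4}\log p,$$ where $$C=\frac{\pi e\sqrt{6}}{3},\qquad g(p)=\sqrt{f\left(\frac{Cp^{1/4}}{2e^2}\right)^{-1}\left(1+\frac{1}{\log p}\right)},$$ and $$f(X)=1-\frac{\pi^2}{3}\left(\frac{\log X}{2X}+\frac{1}{X}+\frac{1}{2X^2}\right).$$
   Context: "$\chi$ is constant on $(N,N+H]$" means that $\chi$ takes the same value at all the integers $N+1,\dots,N+H$. Here $\log$ is the natural logarithm and $e$ is its base. In the displayed formula for $g$, $f(\cdot)^{-1}$ denotes the reciprocal $1/f(\cdot)$. *)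

theory Defs
  imports Complex_Main "HOL-Computational_Algebra.Primes"
begin

text \<open>
  Dirichlet characters are taken on all integers, extended by zero off the residues coprime to the
  modulus. The value 1 at 1 is not listed separately: it follows from multiplicativity
  and the value at 1 being nonzero.
\<close>

definition dirichlet_character :: "nat \<Rightarrow> (int \<Rightarrow> complex) \<Rightarrow> bool" where
  "dirichlet_character q \<chi> \<longleftrightarrow>
     (\<forall>m n. \<chi> (m * n) = \<chi> m * \<chi> n) \<and>
     (\<forall>n. \<chi> (n + int q) = \<chi> n) \<and>
     (\<forall>n. \<chi> n \<noteq> 0 \<longleftrightarrow> coprime n (int q))"

definition principal_character :: "nat \<Rightarrow> int \<Rightarrow> complex" where
  "principal_character q n = (if coprime n (int q) then 1 else 0)"

definition constant_on_interval :: "(int \<Rightarrow> complex) \<Rightarrow> int \<Rightarrow> int \<Rightarrow> bool" where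
  "constant_on_interval \<chi> N H \<longleftrightarrow> (\<exists>c. \<forall>n\<in>{N<..N+H}. \<chi> n = c)"

definition const_C :: real where
  "const_C = pi * exp 1 * sqrt 6 / 3"

definition f_fun :: "real \<Rightarrow> real" where
  "f_fun X = 1 - pi\<^sup>2 / 3 * (ln X / (2 * X) + 1 / X + 1 / (2 * X\<^sup>2))"

definition g_fun :: "nat \<Rightarrow> real" where
  "g_fun p = sqrt (inverse (f_fun (const_C * real p powr (1/4) / (2 * (exp 1)\<^sup>2)))
                   * (1 + 1 / ln (real p)))"

end

theory Submission
  imports Defs "HOL-Analysis.Analysis" "HOL-Number_Theory.Number_Theory"
begin

hide_const (open) up_ring.coeff up_ring.monom
unbundle no vec_syntax

text \<open>
  The proof replaces Weil's bound by Stepanov's method. Since \<open>\<chi>\<close> is non-principal, \<open>\<chi> a = 1\<close> forces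
  \<open>a\<^sup>s = 1\<close> modulo \<open>p\<close> for some \<open>s = (p - 1) / q\<close> with \<open>q \<ge> 2\<close>. If \<open>\<chi>\<close> is constant and nonzero on
  \<open>z, \<dots>, z + k\<close>, then \<open>u = 1 / z\<close> lies in the set \<open>S\<close> of residues with \<open>(1 + j u)\<^sup>s = 1\<close> for all
  \<open>1 \<le> j \<le> k\<close>. With \<open>y\<^sub>j = (1 + j U)\<^sup>s\<close>, an auxiliary polynomial \<open>\<Psi> = \<Sum> U\<^sup>p\<^sup>i P\<^sub>e\<^sub>,\<^sub>i(U) y\<^sup>e\<close>, where
  \<open>0 \<le> e\<^sub>j < q\<close>, can be made to vanish to order about \<open>\<surd>p\<close> on all of \<open>S\<close>, so that \<open>\<bar>S\<bar>\<close> is at most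
  about \<open>2 k \<surd>p\<close> with \<open>k\<close> about \<open>log\<^sub>2 \<surd>p\<close>.

  That \<open>\<Psi>\<close> is not zero follows from two facts. Modulo \<open>U\<^sup>p\<close>, the polynomial \<open>y\<^sub>j\<close> agrees with the
  power series \<open>\<eta>\<^sub>j = (1 + j U)\<close> raised to \<open>- 1 / q\<close>. The monomials in the \<open>\<eta>\<^sub>j\<close> are linearly independent
  over the polynomials: the \<open>p\<close>-th power of a relation of minimal support is a relation with the same
  support, hence proportional to it, and comparing orders at the roots of \<open>1 + j U\<close> leaves only one
  term. A counting argument then bounds the order of vanishing of a combination with coefficients of
  small degree.

  On the other hand, following Burgess, one run of \<open>H\<close> equal values of \<open>\<chi>\<close> produces, by division by the
  integers \<open>q \<le> X\<close>, about \<open>X\<^sup>2\<close> disjoint runs of length \<open>H / X\<close>. If \<open>H\<close> violates the claimed bound,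
  these are too many.
\<close>

section \<open>Congruences in polynomial and power series rings\<close>

text \<open>Integer polynomials and power series modulo \<open>p\<close> stand for those over the
  field with \<open>p\<close> elements, which keeps the prime \<open>p\<close> an ordinary
  variable.\<close>

definition cong_elem :: "'a::comm_ring_1 \<Rightarrow> 'a \<Rightarrow> 'a \<Rightarrow> bool" where
  "cong_elem m a b \<longleftrightarrow> m dvd (a - b)"

lemma cong_elem_refl [simp, intro]: "cong_elem m a a"
  by (simp add: cong_elem_def)

lemma cong_elem_sym: "cong_elem m a b \<Longrightarrow> cong_elem m b a"
  unfolding cong_elem_def by (subst dvd_minus_iff [symmetric]) simp

lemma cong_elem_trans [trans]: "cong_elem m a b \<Longrightarrow> cong_elem m b c \<Longrightarrow> cong_elem m a c"
  unfolding cong_elem_def using dvd_add[of m "a - b" "b - c"] by simp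

lemma cong_elem_add: "cong_elem m a b \<Longrightarrow> cong_elem m c d \<Longrightarrow> cong_elem m (a + c) (b + d)"
  unfolding cong_elem_def using dvd_add[of m "a - b" "c - d"] by (simp add: algebra_simps)

lemma cong_elem_mult: "cong_elem m a b \<Longrightarrow> cong_elem m c d \<Longrightarrow> cong_elem m (a * c) (b * d)"
proof -
  assume "cong_elem m a b" "cong_elem m c d"
  moreover have "a * c - b * d = (a - b) * c + b * (c - d)" by (simp add: algebra_simps)
  ultimately show ?thesis unfolding cong_elem_def by simp
qed

lemma cong_elem_power: "cong_elem m a b \<Longrightarrow> cong_elem m (a ^ n) (b ^ n)"
  by (induction n) (auto intro: cong_elem_mult)

lemma cong_elem_sum: "(\<And>x. x \<in> A \<Longrightarrow> cong_elem m (f x) (g x)) \<Longrightarrow> cong_elem m (sum f A) (sum g A)"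
  unfolding cong_elem_def by (simp add: sum_subtractf [symmetric] dvd_sum)

lemma cong_elem_prod: "(\<And>x. x \<in> A \<Longrightarrow> cong_elem m (f x) (g x)) \<Longrightarrow> cong_elem m (prod f A) (prod g A)"
  by (induction A rule: infinite_finite_induct) (auto intro: cong_elem_mult)

lemma cong_elem_dvd_iff: "cong_elem m a b \<Longrightarrow> m dvd a \<longleftrightarrow> m dvd b"
  unfolding cong_elem_def using dvd_add_right_iff[of m "a - b" b] by simp

lemma cong_elem_0_iff: "cong_elem m a 0 \<longleftrightarrow> m dvd a"
  by (simp add: cong_elem_def)

lemma freshman_dream_mod:
  fixes a b :: "'a::comm_ring_1"
  assumes "prime p"
  shows "cong_elem (of_nat p) ((a + b) ^ p) (a ^ p + b ^ p)"
proof -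
  have p: "p > 1" using assms by (rule prime_gt_1_nat)
  have "(a + b) ^ p = (\<Sum>k\<le>p. of_nat (p choose k) * a ^ k * b ^ (p - k))"
    by (rule binomial_ring)
  also have "{..p} = insert 0 (insert p {1..<p})" using p by auto
  also have "(\<Sum>k\<in>insert 0 (insert p {1..<p}). of_nat (p choose k) * a ^ k * b ^ (p - k)) =
     a ^ p + b ^ p + (\<Sum>k\<in>{1..<p}. of_nat (p choose k) * a ^ k * b ^ (p - k))"
    using p by simp
  finally have "(a + b) ^ p - (a ^ p + b ^ p) = (\<Sum>k\<in>{1..<p}. of_nat (p choose k) * a ^ k * b ^ (p - k))"
    by simp
  moreover have "(of_nat p :: 'a) dvd of_nat (p choose k)" if "k \<in> {1..<p}" for k
  proof -
    have "p dvd (p choose k)" using that assms by (intro dvd_choose_prime) auto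
    then show ?thesis by (metis dvdE dvd_triv_left of_nat_mult)
  qed
  ultimately show ?thesis
    unfolding cong_elem_def by (auto intro!: dvd_sum dvd_mult2)
qed

lemma cong_elem_power_prime_sum:
  fixes f :: "'b \<Rightarrow> 'a::comm_ring_1"
  assumes "prime p" "finite A"
  shows "cong_elem (of_nat p) (sum f A ^ p) (\<Sum>x\<in>A. f x ^ p)"
  using assms(2)
proof (induction A rule: finite_induct)
  case empty
  show ?case using prime_gt_0_nat[OF assms(1)] by (simp add: zero_power)
next
  case (insert x A)
  show ?case
    using cong_elem_trans[OF freshman_dream_mod[OF assms(1), of "f x" "sum f A"]
       cong_elem_add[OF cong_elem_refl insert.IH]] insert.hyps by simp
qed

lemma cong_elem_1_plus_power_prime:
  fixes a :: "'a::comm_ring_1"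
  assumes "prime p"
  shows "cong_elem (of_nat p) ((1 + a) ^ (p ^ M)) (1 + a ^ (p ^ M))"
proof (induction M)
  case (Suc M)
  have "cong_elem (of_nat p) ((1 + a) ^ (p ^ Suc M)) ((1 + a ^ (p ^ M)) ^ p)"
    using cong_elem_power[OF Suc, of p] by (simp add: power_mult [symmetric] mult.commute)
  also have "cong_elem (of_nat p) ((1 + a ^ (p ^ M)) ^ p) (1 ^ p + (a ^ (p ^ M)) ^ p)"
    by (rule freshman_dream_mod[OF assms])
  finally show ?case by (simp add: power_mult [symmetric] mult.commute)
qed simp

section \<open>Divisibility by a prime in integer polynomials and power series\<close>

lemma of_nat_dvd_poly_iff: "of_nat p dvd (f :: int poly) \<longleftrightarrow> (\<forall>n. int p dvd coeff f n)"
  by (simp add: of_nat_poly const_poly_dvd_iff)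

lemma of_nat_dvd_fps_iff: "of_nat p dvd (f :: int fps) \<longleftrightarrow> (\<forall>n. int p dvd fps_nth f n)"
proof
  assume "of_nat p dvd f"
  then obtain g where "f = of_nat p * g" by blast
  then show "\<forall>n. int p dvd fps_nth f n"
    by (metis dvd_triv_left fps_mult_left_const_nth fps_of_nat)
next
  assume *: "\<forall>n. int p dvd fps_nth f n"
  have "f = of_nat p * Abs_fps (\<lambda>n. fps_nth f n div int p)"
    using * by (intro fps_ext) (simp add: fps_of_nat [symmetric] dvd_mult_div_cancel)
  then show "of_nat p dvd f" by (metis dvd_triv_left)
qed

lemma of_nat_dvd_fps_of_poly_iff: "of_nat p dvd fps_of_poly (f :: int poly) \<longleftrightarrow> of_nat p dvd f"
  by (simp add: of_nat_dvd_fps_iff of_nat_dvd_poly_iff)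

lemma prime_elem_of_nat_poly: "prime p \<Longrightarrow> prime_elem (of_nat p :: int poly)"
  by (simp add: of_nat_poly prime_elem_const_poly_iff)

text \<open>As in Gauss's lemma: if \<open>i0\<close> and \<open>j0\<close> are the first indices
  with coefficients prime to \<open>p\<close>, then all but one of the products in the coefficient
  of \<open>a * b\<close> at \<open>i0 + j0\<close> are divisible by \<open>p\<close>.\<close>

lemma prime_elem_of_nat_fps:
  assumes "prime p"
  shows "prime_elem (of_nat p :: int fps)"
proof (rule prime_elemI)
  show "(of_nat p :: int fps) \<noteq> 0" using assms by auto
  show "\<not> (of_nat p :: int fps) dvd 1"
    using prime_gt_1_nat[OF assms] by (auto simp: of_nat_dvd_fps_iff)
  fix a b :: "int fps"
  assume ab: "of_nat p dvd a * b"
  show "of_nat p dvd a \<or> of_nat p dvd b"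
  proof (rule ccontr)
    assume "\<not> (of_nat p dvd a \<or> of_nat p dvd b)"
    then obtain i j where "\<not> int p dvd fps_nth a i" "\<not> int p dvd fps_nth b j"
      by (auto simp: of_nat_dvd_fps_iff)
    define i0 where "i0 = (LEAST i. \<not> int p dvd fps_nth a i)"
    define j0 where "j0 = (LEAST j. \<not> int p dvd fps_nth b j)"
    have i0: "\<not> int p dvd fps_nth a i0" "\<And>i. i < i0 \<Longrightarrow> int p dvd fps_nth a i"
      unfolding i0_def using LeastI[of "\<lambda>i. \<not> int p dvd fps_nth a i"] not_less_Least \<open>\<not> int p dvd fps_nth a i\<close> by blast+
    have j0: "\<not> int p dvd fps_nth b j0" "\<And>i. i < j0 \<Longrightarrow> int p dvd fps_nth b i"
      unfolding j0_def using LeastI[of "\<lambda>i. \<not> int p dvd fps_nth b i"] not_less_Least \<open>\<not> int p dvd fps_nth b j\<close> by blast+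
    have "fps_nth (a * b) (i0 + j0) = (\<Sum>i=0..i0+j0. fps_nth a i * fps_nth b (i0 + j0 - i))"
      by (rule fps_mult_nth)
    also have "\<dots> = fps_nth a i0 * fps_nth b j0 + (\<Sum>i\<in>{0..i0+j0}-{i0}. fps_nth a i * fps_nth b (i0 + j0 - i))"
      by (subst sum.remove[of _ i0]) auto
    finally have eq: "fps_nth (a * b) (i0 + j0) = \<dots>" .
    have "int p dvd (\<Sum>i\<in>{0..i0+j0}-{i0}. fps_nth a i * fps_nth b (i0 + j0 - i))"
    proof (rule dvd_sum)
      fix i assume i: "i \<in> {0..i0+j0}-{i0}"
      show "int p dvd fps_nth a i * fps_nth b (i0 + j0 - i)"
      proof (cases "i < i0")
        case True then show ?thesis by (intro dvd_mult2 i0(2))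
      next
        case False
        with i have "i0 + j0 - i < j0" by auto
        then show ?thesis by (intro dvd_mult j0(2))
      qed
    qed
    moreover have "int p dvd fps_nth (a * b) (i0 + j0)" using ab by (simp add: of_nat_dvd_fps_iff)
    ultimately have "int p dvd fps_nth a i0 * fps_nth b j0"
      unfolding eq by (subst (asm) dvd_add_left_iff)
    then show False using i0(1) j0(1) assms by (simp add: prime_dvd_mult_iff)
  qed
qed

lemma cong_elem_cancel_left:
  fixes c :: "'a::idom"
  assumes "prime_elem m" "\<not> m dvd c" "cong_elem m (c * a) (c * b)"
  shows "cong_elem m a b"
  using assms prime_elem_dvd_mult_iff[of m c "a - b"] unfolding cong_elem_def by (simp add: algebra_simps)

lemma prime_elem_not_dvd_power: "prime_elem m \<Longrightarrow> \<not> m dvd c \<Longrightarrow> \<not> m dvd (c ^ n)"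
  for c :: "'a::idom"
  using prime_elem_dvd_power by blast

lemma prime_elem_not_dvd_prod:
  fixes f :: "'b \<Rightarrow> 'a::idom"
  assumes "prime_elem m" "\<And>x. x \<in> A \<Longrightarrow> \<not> m dvd f x"
  shows "\<not> m dvd prod f A"
  using assms(2)
proof (induction A rule: infinite_finite_induct)
  case (insert x A)
  then show ?case using assms(1) by (simp add: prime_elem_dvd_mult_iff)
qed (use assms(1) in \<open>auto simp: prime_elem_def\<close>)

text \<open>Pigeonhole in place of linear algebra: there are more vectors with entries in
  \<open>{0..<p}\<close> than value patterns modulo \<open>p\<close>. Two vectors collide, and since
  \<open>\<phi>\<close> respects differences, their difference solves the system.\<close>

lemma exists_nontrivial_solution_mod:
  fixes \<phi> :: "('a \<Rightarrow> int) \<Rightarrow> 'c \<Rightarrow> int"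
  assumes "p > 1" "finite A" "finite C" "card C < card A"
    and "\<And>x y c. c \<in> C \<Longrightarrow> \<phi> (\<lambda>a. x a - y a) c = \<phi> x c - \<phi> y c"
  obtains x where "\<And>a. a \<notin> A \<Longrightarrow> x a = 0" "\<exists>a\<in>A. \<not> int p dvd x a" "\<And>c. c \<in> C \<Longrightarrow> int p dvd \<phi> x c"
proof -
  let ?S = "A \<rightarrow>\<^sub>E {0..<int p}" and ?T = "C \<rightarrow>\<^sub>E {0..<int p}"
  define z where "z = (\<lambda>f. \<lambda>a. if a \<in> A then f a else (0::int))"
  define F where "F = (\<lambda>f. restrict (\<lambda>c. \<phi> (z f) c mod int p) C)"
  have "card ?T < card ?S"
    using assms by (simp add: card_funcsetE)
  moreover have "F ` ?S \<subseteq> ?T" unfolding F_def using assms(1) by auto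
  moreover have "finite ?T" using assms by (intro finite_PiE) auto
  ultimately have "\<not> inj_on F ?S"
    by (metis card_inj_on_le linorder_not_less)
  then obtain f g where fg: "f \<in> ?S" "g \<in> ?S" "f \<noteq> g" "F f = F g" by (auto simp: inj_on_def)
  from fg(1-3) obtain a where a: "a \<in> A" "f a \<noteq> g a" by (metis PiE_ext)
  define x where "x = (\<lambda>a. z f a - z g a)"
  show thesis
  proof
    show "x a = 0" if "a \<notin> A" for a using that by (simp add: x_def z_def)
    have "f a \<in> {0..<int p}" "g a \<in> {0..<int p}" using fg a by auto
    then have "\<not> int p dvd f a - g a" using a(2)
      by (metis atLeastLessThan_iff mod_eq_dvd_iff mod_pos_pos_trivial)
    then show "\<exists>a\<in>A. \<not> int p dvd x a" using a(1) by (auto simp: x_def z_def)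
    fix c assume c: "c \<in> C"
    have "\<phi> (z f) c mod int p = \<phi> (z g) c mod int p"
      using fun_cong[OF fg(4), of c] c by (simp add: F_def)
    then show "int p dvd \<phi> x c"
      unfolding x_def using assms(5)[OF c] by (simp add: mod_eq_dvd_iff)
  qed
qed

text \<open>Membership in the ideal generated by \<open>p\<close> and \<open>U ^ N\<close>.\<close>

definition vanishes :: "nat \<Rightarrow> nat \<Rightarrow> int fps \<Rightarrow> bool" where
  "vanishes p N f \<longleftrightarrow> (\<forall>n<N. int p dvd fps_nth f n)"

lemma vanishes_add: "vanishes p N f \<Longrightarrow> vanishes p N g \<Longrightarrow> vanishes p N (f + g)"
  and vanishes_diff: "vanishes p N f \<Longrightarrow> vanishes p N g \<Longrightarrow> vanishes p N (f - g)"
  by (auto simp: vanishes_def)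

lemma vanishes_mult: "vanishes p N f \<Longrightarrow> vanishes p N (f * g)"
  unfolding vanishes_def by (auto simp: fps_mult_nth intro!: dvd_sum dvd_mult2)

lemma vanishes_mult_left: "vanishes p N f \<Longrightarrow> vanishes p N (g * f)"
  using vanishes_mult[of p N f g] by (simp add: mult.commute)

lemma vanishes_sum: "(\<And>x. x \<in> A \<Longrightarrow> vanishes p N (f x)) \<Longrightarrow> vanishes p N (sum f A)"
  unfolding vanishes_def by (auto simp: fps_sum_nth intro!: dvd_sum)

lemma vanishes_mono: "vanishes p N f \<Longrightarrow> M \<le> N \<Longrightarrow> vanishes p M f"
  by (auto simp: vanishes_def)

lemma vanishes_of_nat_dvd: "of_nat p dvd f \<Longrightarrow> vanishes p N f"
  by (auto simp: vanishes_def of_nat_dvd_fps_iff)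

lemma vanishes_power_diff:
  assumes "vanishes p N (f - g)"
  shows "vanishes p N (f ^ n - g ^ n)"
proof (induction n)
  case (Suc n)
  have "f ^ Suc n - g ^ Suc n = (f - g) * f ^ n + g * (f ^ n - g ^ n)" by (simp add: algebra_simps)
  with Suc assms show ?case by (metis vanishes_add vanishes_mult vanishes_mult_left)
qed (simp add: vanishes_def)

lemma vanishes_prod_diff:
  assumes "\<And>x. x \<in> A \<Longrightarrow> vanishes p N (f x - g x)"
  shows "vanishes p N (prod f A - prod g A)"
  using assms
proof (induction A rule: infinite_finite_induct)
  case (insert x A)
  have "prod f (insert x A) - prod g (insert x A)
      = (f x - g x) * prod f A + g x * (prod f A - prod g A)"
    using insert.hyps by (simp add: algebra_simps)
  moreover have "vanishes p N (f x - g x)" "vanishes p N (prod f A - prod g A)"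
    using insert by auto
  ultimately show ?case by (metis vanishes_add vanishes_mult vanishes_mult_left)
qed (simp_all add: vanishes_def)

section \<open>Orders of vanishing at a point modulo \<open>p\<close>\<close>

lemma exists_order_mod:
  fixes f :: "int poly"
  assumes "prime p" "\<not> of_nat p dvd f"
  shows "\<exists>a g. cong_elem (of_nat p) f ([:-v, 1:] ^ a * g) \<and> \<not> int p dvd poly g v"
  using assms(2)
proof (induction "degree f" arbitrary: f rule: less_induct)
  case less
  show ?case
  proof (cases "int p dvd poly f v")
    case False
    then show ?thesis by (intro exI[of _ 0] exI[of _ f]) simp
  next
    case True
    define h where "h = synthetic_div f v"
    have f: "f = [:-v, 1:] * h + [:poly f v:]"
      unfolding h_def by (rule synthetic_div_correct'[symmetric])
    have fh: "cong_elem (of_nat p) f ([:-v, 1:] * h)"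
      using True unfolding cong_elem_def by (subst f) (simp add: of_nat_poly)
    have nh: "\<not> of_nat p dvd h"
      using cong_elem_dvd_iff[OF fh] less.prems dvd_mult by blast
    \<comment> \<open>A constant that vanishes modulo \<open>p\<close> is divisible by
      \<open>p\<close>. So each division by \<open>U - v\<close> lowers the degree, and the
      recursion ends.\<close>
    have "degree f \<noteq> 0"
    proof
      assume "degree f = 0"
      then obtain c where "f = [:c:]" by (rule degree_eq_zeroE)
      then show False using True less.prems by (simp add: of_nat_poly)
    qed
    then have "degree h < degree f" unfolding h_def by (simp add: degree_synthetic_div)
    from less.hyps[OF this nh] obtain a g where
      ag: "cong_elem (of_nat p) h ([:-v, 1:] ^ a * g)" "\<not> int p dvd poly g v" by blast
    have "cong_elem (of_nat p) f ([:-v, 1:] ^ Suc a * g)"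
      using cong_elem_trans[OF fh cong_elem_mult[OF cong_elem_refl ag(1)]] by (simp only: power_Suc mult.assoc)
    with ag(2) show ?thesis by blast
  qed
qed

lemma cong_elem_poly: "cong_elem (of_nat p) f g \<Longrightarrow> cong_elem (int p) (poly f v) (poly g v)"
proof -
  assume "cong_elem (of_nat p) f g"
  then obtain h where "f - g = of_nat p * h" unfolding cong_elem_def by blast
  then have "poly f v - poly g v = int p * poly h v"
    by (metis poly_diff poly_mult poly_of_nat)
  then show ?thesis unfolding cong_elem_def by simp
qed

text \<open>If the exponents differed, the smaller power of \<open>l\<close> would cancel, and
  evaluation at \<open>v\<close> would make one of the cofactors divisible by
  \<open>p\<close>.\<close>

lemma order_mod_unique:
  fixes l :: "int poly"
  assumes "prime p" "\<not> of_nat p dvd l" "int p dvd poly l v"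
    and eq: "cong_elem (of_nat p) (l ^ m * f) (l ^ n * g)"
    and "\<not> int p dvd poly f v" "\<not> int p dvd poly g v"
  shows "m = n"
proof -
  have aux: "\<not> m < n" if eq: "cong_elem (of_nat p) (l ^ m * f) (l ^ n * g)" and f: "\<not> int p dvd poly f v" for m n f g
  proof
    assume "m < n"
    then have "l ^ n * g = l ^ m * (l * (l ^ (n - m - 1) * g))"
      by (metis Suc_diff_Suc add_diff_inverse_nat diff_Suc_1 diff_diff_left less_imp_not_less mult.assoc plus_1_eq_Suc power_Suc power_add add.commute)
    with eq have "cong_elem (of_nat p) (l ^ m * f) (l ^ m * (l * (l ^ (n - m - 1) * g)))" by metis
    then have "cong_elem (of_nat p) f (l * (l ^ (n - m - 1) * g))"
      by (rule cong_elem_cancel_left[rotated -1])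
        (intro prime_elem_of_nat_poly prime_elem_not_dvd_power assms)+
    then have "cong_elem (int p) (poly f v) (poly l v * poly (l ^ (n - m - 1) * g) v)"
      using cong_elem_poly by force
    then show False using f assms(3) by (simp add: cong_elem_dvd_iff)
  qed
  from aux[OF eq assms(5)] aux[OF cong_elem_sym[OF eq] assms(6)] show ?thesis by simp
qed

lemma power_mult_collect: "(l ^ b * h) ^ n * (l ^ c * z) = l ^ (b * n + c) * (h ^ n * z)"
  for l h z :: "'a::comm_monoid_mult"
  by (simp add: power_mult_distrib power_mult power_add mult_ac)

section \<open>Linear independence of products of binomial series\<close>

text \<open>\<open>q\<close> will be the order of the character and \<open>s\<close> the exponent
  \<open>(p - 1) / q\<close>. The range of \<open>J\<close> makes the roots \<open>-1 / j\<close> of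
  the factors \<open>1 + j U\<close> exist and differ modulo \<open>p\<close>.\<close>

locale power_residue_setting =
  fixes p q s :: nat and J :: "int set"
  assumes prime_p: "prime p" and p_eq: "p = q * s + 1" and q_gt_0: "q > 0"
    and finite_J: "finite J" and J_subset: "J \<subseteq> {1..<int p}"
begin

definition eta_exp :: "nat \<Rightarrow> nat" where "eta_exp M = s * (\<Sum>i<M. p ^ i)"

lemma eta_exp_Suc: "eta_exp (Suc M) = eta_exp M + s * p ^ M"
  by (simp add: eta_exp_def distrib_left)

lemma eta_exp_1: "eta_exp 1 = s"
  by (simp add: eta_exp_def)

lemma q_eta_exp: "q * eta_exp M + 1 = p ^ M"
proof (induction M)
  case (Suc M)
  have "q * eta_exp (Suc M) + 1 = (q * eta_exp M + 1) + (q * s) * p ^ M"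
    by (simp add: eta_exp_Suc algebra_simps)
  also have "\<dots> = p ^ M + (q * s) * p ^ M" by (simp only: Suc.IH)
  also have "\<dots> = (q * s + 1) * p ^ M" by (simp add: algebra_simps)
  also have "\<dots> = p ^ Suc M" by (simp only: p_eq [symmetric] power_Suc)
  finally show ?case .
qed (simp add: eta_exp_def)

section \<open>The binomial series of \<open>1 + j U\<close> with exponent
  \<open>-1 / q\<close>\<close>

definition lin_fps :: "int \<Rightarrow> int fps" where "lin_fps j = fps_of_poly [:1, j:]"

lemma lin_fps_altdef: "lin_fps j = 1 + fps_const j * fps_X"
  by (simp add: lin_fps_def fps_of_poly_pCons)

lemma vanishes_lin_fps_power: "vanishes p (p ^ M) (lin_fps j ^ (p ^ M) - 1)"
proof -
  have "cong_elem (of_nat p) (lin_fps j ^ (p ^ M)) (1 + (fps_const j * fps_X) ^ (p ^ M))"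
    unfolding lin_fps_altdef by (rule cong_elem_1_plus_power_prime[OF prime_p])
  then have "vanishes p (p ^ M) (lin_fps j ^ (p ^ M) - (1 + (fps_const j * fps_X) ^ (p ^ M)))"
    unfolding cong_elem_def by (rule vanishes_of_nat_dvd)
  moreover have "vanishes p (p ^ M) ((fps_const j * fps_X) ^ (p ^ M))"
    unfolding vanishes_def power_mult_distrib fps_const_power
    by (auto simp: fps_X_power_nth)
  ultimately have "vanishes p (p ^ M) ((lin_fps j ^ (p ^ M) - (1 + (fps_const j * fps_X) ^ (p ^ M))) + (fps_const j * fps_X) ^ (p ^ M))"
    by (rule vanishes_add)
  then show ?thesis by (simp add: algebra_simps)
qed

text \<open>Raising the index \<open>M + d\<close> by one multiplies by the \<open>s\<close>-th
  power of \<open>(1 + j U) ^ (p ^ (M + d))\<close>, which is 1 modulo \<open>p\<close> up to order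
  \<open>p ^ (M + d)\<close>.\<close>

lemma vanishes_lin_fps_stable: "vanishes p (p ^ M) (lin_fps j ^ eta_exp (M + d) - lin_fps j ^ eta_exp M)"
proof (induction d)
  case (Suc d)
  have "vanishes p (p ^ (M + d)) (((lin_fps j ^ (p ^ (M + d))) ^ s - 1 ^ s))"
    by (rule vanishes_power_diff[OF vanishes_lin_fps_power])
  then have "vanishes p (p ^ M) ((lin_fps j ^ (p ^ (M + d))) ^ s - 1 ^ s)"
    by (rule vanishes_mono) (use prime_gt_0_nat[OF prime_p] in \<open>auto intro: power_increasing\<close>)
  then have "vanishes p (p ^ M) (lin_fps j ^ eta_exp (M + d) * ((lin_fps j ^ (p ^ (M + d))) ^ s - 1 ^ s))"
    by (rule vanishes_mult_left)
  also have "lin_fps j ^ eta_exp (M + d) * ((lin_fps j ^ (p ^ (M + d))) ^ s - 1 ^ s) = lin_fps j ^ eta_exp (M + Suc d) - lin_fps j ^ eta_exp (M + d)"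
    by (simp add: eta_exp_Suc power_add right_diff_distrib mult.commute[of s] power_mult)
  finally show ?case using vanishes_add[OF _ Suc.IH] by force
qed (simp add: vanishes_def)

text \<open>Modulo \<open>p\<close> this is the binomial series of \<open>1 + j U\<close> with exponent \<open>- 1 / q\<close>: the exponents
  \<open>eta_exp n = (p\<^sup>n - 1) / q\<close> converge \<open>p\<close>-adically to \<open>- 1 / q\<close>.\<close>

definition eta :: "int \<Rightarrow> int fps" where
  "eta j = Abs_fps (\<lambda>n. fps_nth (lin_fps j ^ eta_exp n) n)"

lemma vanishes_eta: "vanishes p (p ^ M) (eta j - lin_fps j ^ eta_exp M)"
  unfolding vanishes_def
proof (intro allI impI)
  fix n assume n: "n < p ^ M"
  \<comment> \<open>Index \<open>M\<close> settles the coefficients below \<open>p ^ M\<close>. By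
    this inequality index \<open>n\<close> already settles coefficient \<open>n\<close>, which
    justifies the diagonal choice in \<open>eta\<close>.\<close>
  have n': "n < p ^ n" using prime_gt_1_nat[OF prime_p] by (simp add: less_exp power_gt_expt)
  show "int p dvd fps_nth (eta j - lin_fps j ^ eta_exp M) n"
  proof (cases "n \<le> M")
    case True
    then have "int p dvd fps_nth (lin_fps j ^ eta_exp M - lin_fps j ^ eta_exp n) n"
      using vanishes_lin_fps_stable[of n j "M - n"] n' by (auto simp: vanishes_def)
    then show ?thesis by (simp add: eta_def dvd_diff_commute)
  next
    case False
    then have "int p dvd fps_nth (lin_fps j ^ eta_exp n - lin_fps j ^ eta_exp M) n"
      using vanishes_lin_fps_stable[of M j "n - M"] n by (auto simp: vanishes_def)
    then show ?thesis by (simp add: eta_def)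
  qed
qed

text \<open>Since \<open>q * eta_exp M + 1 = p ^ M\<close>, the truncated identity reads
  \<open>(1 + j U) ^ (p ^ M) = 1\<close> up to order \<open>p ^ M\<close>, and \<open>M\<close> is
  arbitrary.\<close>

lemma eta_power_q: "cong_elem (of_nat p) (eta j ^ q * lin_fps j) 1"
proof -
  have "vanishes p (p ^ M) (eta j ^ q * lin_fps j - 1)" for M
  proof -
    have "vanishes p (p ^ M) ((eta j ^ q - (lin_fps j ^ eta_exp M) ^ q) * lin_fps j + (lin_fps j ^ (p ^ M) - 1))"
      by (intro vanishes_add vanishes_mult vanishes_power_diff vanishes_eta vanishes_lin_fps_power)
    moreover have "lin_fps j ^ (p ^ M) = (lin_fps j ^ eta_exp M) ^ q * lin_fps j"
      unfolding q_eta_exp[symmetric] by (simp add: power_mult [symmetric] mult.commute)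
    ultimately show ?thesis by (simp add: left_diff_distrib)
  qed
  moreover have "n < p ^ n" for n using prime_gt_1_nat[OF prime_p] by (simp add: power_gt_expt)
  ultimately show ?thesis unfolding cong_elem_def of_nat_dvd_fps_iff vanishes_def by blast
qed

lemma not_dvd_lin: "\<not> of_nat p dvd [:1, j :: int:]"
proof
  assume "of_nat p dvd [:1, j :: int:]"
  then have "int p dvd coeff [:1, j:] 0" unfolding of_nat_dvd_poly_iff by blast
  then show False using prime_gt_1_nat[OF prime_p] by simp
qed

lemma not_dvd_eta: "\<not> of_nat p dvd eta j"
proof
  assume "of_nat p dvd eta j"
  then have "of_nat p dvd eta j ^ q * lin_fps j" using q_gt_0 by (simp add: dvd_power dvd_mult2 dvd_trans)
  then have "of_nat p dvd (1 :: int fps)" using cong_elem_dvd_iff[OF eta_power_q] by blast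
  then show False using prime_elem_of_nat_fps[OF prime_p] by (simp add: prime_elem_def)
qed

section \<open>Monomials in the binomial series and their polynomial counterparts\<close>

definition eta_mon :: "(int \<Rightarrow> nat) \<Rightarrow> int fps" where "eta_mon e = (\<Prod>j\<in>J. eta j ^ e j)"

definition lin_mon :: "(int \<Rightarrow> nat) \<Rightarrow> int poly" where "lin_mon e = (\<Prod>j\<in>J. [:1, j:] ^ (s * e j))"

definition exponents :: "(int \<Rightarrow> nat) set" where "exponents = J \<rightarrow>\<^sub>E {..<q}"

lemma finite_exponents: "finite exponents"
  unfolding exponents_def using finite_J by (intro finite_PiE) auto

lemma card_exponents: "card exponents = q ^ card J"
  unfolding exponents_def using finite_J by (simp add: card_funcsetE)

lemma exponents_less: "e \<in> exponents \<Longrightarrow> j \<in> J \<Longrightarrow> e j < q"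
  unfolding exponents_def by auto

lemma not_dvd_eta_mon: "\<not> of_nat p dvd eta_mon e"
  unfolding eta_mon_def
  by (intro prime_elem_not_dvd_prod prime_elem_not_dvd_power prime_elem_of_nat_fps prime_p not_dvd_eta)

text \<open>The case \<open>M = 1\<close> of \<open>vanishes_eta\<close>: as
  \<open>eta_exp 1 = s\<close>, the series \<open>eta j\<close> agrees with
  \<open>(1 + j U) ^ s\<close> to order \<open>p\<close>.\<close>

lemma vanishes_eta_mon_lin_mon: "vanishes p p (eta_mon e - fps_of_poly (lin_mon e))"
proof -
  have "vanishes p (p ^ 1) (eta j ^ e j - (lin_fps j ^ eta_exp 1) ^ e j)" for j
    by (rule vanishes_power_diff[OF vanishes_eta])
  then have "vanishes p p (eta j ^ e j - lin_fps j ^ (s * e j))" for j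
    by (simp add: eta_exp_1 power_mult del: One_nat_def)
  then show ?thesis
    unfolding eta_mon_def lin_mon_def fps_of_poly_prod fps_of_poly_power lin_fps_def [symmetric]
    by (intro vanishes_prod_diff)
qed

text \<open>Raising a relation to the \<open>p\<close>-th power turns \<open>eta j ^ (p * e j)\<close> back into
  \<open>eta j ^ e j\<close> times a power of \<open>1 + j U\<close>.\<close>

lemma eta_mon_power_p:
  assumes "e \<in> exponents"
  shows "cong_elem (of_nat p) (eta_mon e ^ p * (\<Prod>j\<in>J. lin_fps j ^ (s * (q - 1))))
           (eta_mon e * (\<Prod>j\<in>J. lin_fps j ^ (s * (q - 1 - e j))))"
proof -
  have "cong_elem (of_nat p) ((eta j ^ e j) ^ p * lin_fps j ^ (s * (q - 1))) (eta j ^ e j * lin_fps j ^ (s * (q - 1 - e j)))"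
    if j: "j \<in> J" for j
  proof -
    from exponents_less[OF assms j] have "q - 1 = e j + (q - 1 - e j)" by simp
    then have 1: "s * (q - 1) = s * e j + s * (q - 1 - e j)" by (metis distrib_left)
    have 2: "e j * p = e j + q * (s * e j)" by (simp add: p_eq algebra_simps)
    have "(eta j ^ e j) ^ p * lin_fps j ^ (s * (q - 1)) = (eta j ^ q * lin_fps j) ^ (s * e j) * (eta j ^ e j * lin_fps j ^ (s * (q - 1 - e j)))"
      unfolding 1 power_mult[symmetric] 2 power_add power_mult_distrib by (simp add: mult_ac)
    moreover have "cong_elem (of_nat p) \<dots> (1 ^ (s * e j) * (eta j ^ e j * lin_fps j ^ (s * (q - 1 - e j))))"
      by (intro cong_elem_mult cong_elem_power eta_power_q cong_elem_refl)
    ultimately show ?thesis by simp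
  qed
  then show ?thesis
    unfolding eta_mon_def prod_power_distrib [symmetric] prod.distrib [symmetric]
    by (auto intro!: cong_elem_prod simp: prod_power_distrib prod.distrib [symmetric])
qed

text \<open>The root is \<open>v = - u\<close> with \<open>u = 1 / j\<close>. As
  \<open>U - v = u (1 + j U)\<close> modulo \<open>p\<close>, the last claim lets orders at
  \<open>v\<close> be measured with \<open>1 + j U\<close>, the factor that occurs in the
  monomials.\<close>

lemma root_lin:
  assumes "j \<in> J"
  obtains v where "int p dvd poly [:1, j:] v" "\<And>i. i \<in> J \<Longrightarrow> i \<noteq> j \<Longrightarrow> \<not> int p dvd poly [:1, i:] v"
    "\<And>a. \<exists>c. cong_elem (of_nat p) ([:-v, 1:] ^ a) ([:1, j:] ^ a * [:c:]) \<and> \<not> int p dvd c"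
proof -
  have j: "1 \<le> j" "j < int p" using assms J_subset by auto
  then have cop: "coprime j (int p)"
    using prime_p by (metis coprime_commute prime_imp_coprime prime_nat_int_transfer zdvd_not_zless zero_less_one less_le_trans)
  then obtain u where u: "[j * u = 1] (mod int p)" by (metis cong_solve_coprime_int)
  then have pu: "int p dvd j * u - 1" by (simp add: cong_iff_dvd_diff)
  define v where "v = - u"
  have pv: "int p dvd 1 + j * v" using pu unfolding v_def by (metis dvd_minus_iff minus_diff_eq mult_minus_right diff_conv_add_uminus)
  have nu: "\<not> int p dvd u"
  proof
    assume "int p dvd u"
    then have "int p dvd 1" using pu by (metis dvd_diff_right_iff dvd_mult)
    then show False using prime_gt_1_nat[OF prime_p] by simp
  qed
  show thesis
  proof
    show "int p dvd poly [:1, j:] v" using pv by (simp add: mult.commute)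
    fix i assume i: "i \<in> J" "i \<noteq> j"
    show "\<not> int p dvd poly [:1, i:] v"
    proof
      assume "int p dvd poly [:1, i:] v"
      then have "int p dvd (1 + i * v) - (1 + j * v)" using pv by (metis dvd_diff mult.commute poly_pCons poly_0 mult_zero_right add.right_neutral)
      then have "int p dvd (i - j) * v" by (simp add: algebra_simps)
      then have "int p dvd i - j" using nu prime_p unfolding v_def by (simp add: prime_dvd_mult_iff)
      moreover have "1 \<le> i" "i < int p" using i(1) J_subset by auto
      then have "\<bar>i - j\<bar> < int p" using j by linarith
      ultimately show False using i(2) by (metis dvd_imp_le_int eq_iff_diff_eq_0 linorder_not_less abs_of_nat)
    qed
  next
    fix a
    have "cong_elem (of_nat p) [:-v, 1:] ([:1, j:] * [:u:])"
    proof -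
      have "[:-v, 1:] - [:1, j:] * [:u:] = [:0, 1 - u * j:]" by (simp add: v_def)
      moreover have "int p dvd 1 - u * j" using pu by (simp add: dvd_diff_commute mult.commute)
      ultimately show ?thesis unfolding cong_elem_def by (simp only:) (simp add: of_nat_dvd_poly_iff coeff_pCons split: nat.split)
    qed
    then have "cong_elem (of_nat p) ([:-v, 1:] ^ a) (([:1, j:] * [:u:]) ^ a)" by (rule cong_elem_power)
    also have "([:1, j:] * [:u:]) ^ a = [:1, j:] ^ a * [:u ^ a:]"
      by (simp only: power_mult_distrib poly_const_pow)
    finally have "cong_elem (of_nat p) ([:-v, 1:] ^ a) ([:1, j:] ^ a * [:u ^ a:])" .
    moreover have "\<not> int p dvd u ^ a" using nu prime_p by (metis prime_dvd_power prime_nat_int_transfer)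
    ultimately show "\<exists>c. cong_elem (of_nat p) ([:-v, 1:] ^ a) ([:1, j:] ^ a * [:c:]) \<and> \<not> int p dvd c" by blast
  qed
qed

lemma linear_independence:
  assumes "A \<subseteq> exponents" "of_nat p dvd (\<Sum>e\<in>A. fps_of_poly (Q e) * eta_mon e)" "e \<in> A"
  shows "of_nat p dvd Q e"
proof -
  have "finite A" using assms(1) finite_exponents by (rule finite_subset)
  then have "\<forall>e\<in>A. of_nat p dvd Q e" using assms(1,2)
  proof (induction A arbitrary: Q rule: finite_psubset_induct)
    case (psubset A)
    note ring_p = prime_elem_of_nat_poly[OF prime_p]
    show ?case
    proof (rule ccontr)
      assume "\<not> (\<forall>e\<in>A. of_nat p dvd Q e)"
      then obtain e0 where e0: "e0 \<in> A" "\<not> of_nat p dvd Q e0" by blast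
      \<comment> \<open>If one coefficient vanished, dropping it would leave a shorter relation,
        trivial by induction, against the choice of \<open>e0\<close>.\<close>
      have nd: "\<not> of_nat p dvd Q e" if e: "e \<in> A" for e
      proof
        assume d: "of_nat p dvd Q e"
        have "of_nat p dvd (\<Sum>e\<in>A. fps_of_poly (Q e) * eta_mon e) - fps_of_poly (Q e) * eta_mon e"
          using psubset.prems(2) d by (intro dvd_diff dvd_mult2) (simp_all add: of_nat_dvd_fps_of_poly_iff)
        then have "of_nat p dvd (\<Sum>e\<in>A-{e}. fps_of_poly (Q e) * eta_mon e)"
          using psubset.hyps e by (simp add: sum_diff1)
        then have "\<forall>e\<in>A-{e}. of_nat p dvd Q e"
          using psubset.prems e by (intro psubset.IH) auto
        then show False using e0 d by blast
      qed
      \<comment> \<open>The coefficients of the \<open>p\<close>-th power of the relation times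
        \<open>?W\<close>, rewritten in the monomials \<open>eta_mon e\<close> by
        \<open>eta_mon_power_p\<close>.\<close>
      define Q' where "Q' e = Q e ^ p * (\<Prod>j\<in>J. [:1, j:] ^ (s * (q - 1 - e j)))" for e
      let ?W = "\<Prod>j\<in>J. lin_fps j ^ (s * (q - 1))"
      have fQ': "fps_of_poly (Q' e) = fps_of_poly (Q e) ^ p * (\<Prod>j\<in>J. lin_fps j ^ (s * (q - 1 - e j)))" for e
        by (simp add: Q'_def fps_of_poly_mult fps_of_poly_power fps_of_poly_prod lin_fps_def)
      have "cong_elem (of_nat p) ((\<Sum>e\<in>A. fps_of_poly (Q e) * eta_mon e) ^ p * ?W)
              ((\<Sum>e\<in>A. (fps_of_poly (Q e) * eta_mon e) ^ p) * ?W)"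
        by (intro cong_elem_mult cong_elem_power_prime_sum prime_p psubset.hyps cong_elem_refl)
      also have "(\<Sum>e\<in>A. (fps_of_poly (Q e) * eta_mon e) ^ p) * ?W
          = (\<Sum>e\<in>A. fps_of_poly (Q e) ^ p * (eta_mon e ^ p * ?W))"
        by (simp add: sum_distrib_right power_mult_distrib mult.assoc)
      also have "cong_elem (of_nat p) \<dots> (\<Sum>e\<in>A. fps_of_poly (Q e) ^ p * (eta_mon e * (\<Prod>j\<in>J. lin_fps j ^ (s * (q - 1 - e j)))))"
        using psubset.prems(1) by (intro cong_elem_sum cong_elem_mult cong_elem_refl eta_mon_power_p) auto
      also have "\<dots> = (\<Sum>e\<in>A. fps_of_poly (Q' e) * eta_mon e)"
        by (intro sum.cong) (simp_all add: fQ' mult_ac)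
      finally have "cong_elem (of_nat p) ((\<Sum>e\<in>A. fps_of_poly (Q e) * eta_mon e) ^ p * ?W) (\<Sum>e\<in>A. fps_of_poly (Q' e) * eta_mon e)" .
      moreover have "of_nat p dvd (\<Sum>e\<in>A. fps_of_poly (Q e) * eta_mon e) ^ p * ?W"
        using psubset.prems(2) prime_gt_0_nat[OF prime_p] by (intro dvd_mult2) (meson dvd_power dvd_trans)
      ultimately have rel': "of_nat p dvd (\<Sum>e\<in>A. fps_of_poly (Q' e) * eta_mon e)"
        using cong_elem_dvd_iff by blast
      \<comment> \<open>Eliminating \<open>e0\<close> from the two relations gives a shorter one. By
        induction all \<open>R e\<close> vanish, so the relations are proportional.\<close>
      define R where "R e = Q e * Q' e0 - Q' e * Q e0" for e
      have "(\<Sum>e\<in>A. fps_of_poly (R e) * eta_mon e) =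
          fps_of_poly (Q' e0) * (\<Sum>e\<in>A. fps_of_poly (Q e) * eta_mon e)
          - fps_of_poly (Q e0) * (\<Sum>e\<in>A. fps_of_poly (Q' e) * eta_mon e)"
        by (simp add: R_def fps_of_poly_diff fps_of_poly_mult sum_distrib_left sum_subtractf[symmetric] algebra_simps)
      then have "of_nat p dvd (\<Sum>e\<in>A. fps_of_poly (R e) * eta_mon e)"
        using rel' psubset.prems(2) by (simp add: dvd_diff)
      moreover have "(\<Sum>e\<in>A. fps_of_poly (R e) * eta_mon e) = (\<Sum>e\<in>A-{e0}. fps_of_poly (R e) * eta_mon e)"
        using psubset.hyps by (subst sum.remove[OF _ e0(1)]) (simp_all add: R_def)
      ultimately have R: "\<forall>e\<in>A-{e0}. of_nat p dvd R e"
        using psubset.prems e0 by (intro psubset.IH) auto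
      \<comment> \<open>Given a second exponent \<open>e\<close>, proportionality is examined at the
        root \<open>v\<close> of a factor \<open>1 + j U\<close> with
        \<open>e j \<noteq> e0 j\<close>.\<close>
      have "A = {e0}"
      proof (rule ccontr)
        assume "A \<noteq> {e0}"
        then obtain e where e: "e \<in> A" "e \<noteq> e0" using e0 by blast
        then obtain j where j: "j \<in> J" "e j \<noteq> e0 j"
          using psubset.prems(1) e0(1) unfolding exponents_def by (metis PiE_ext subsetD)
        obtain v where v: "int p dvd poly [:1, j:] v"
          "\<And>i. i \<in> J \<Longrightarrow> i \<noteq> j \<Longrightarrow> \<not> int p dvd poly [:1, i:] v"
          "\<And>a. \<exists>c. cong_elem (of_nat p) ([:-v, 1:] ^ a) ([:1, j:] ^ a * [:c:]) \<and> \<not> int p dvd c"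
          using root_lin[OF j(1)] by metis
        let ?Z = "\<lambda>e. \<Prod>i\<in>J-{j}. [:1, i:] ^ (s * (q - 1 - e i))"
        have nz: "\<not> int p dvd poly (?Z e) v" for e
          unfolding poly_prod poly_power using v(2) prime_p
          by (intro prime_elem_not_dvd_prod prime_elem_not_dvd_power) auto
        have ord: "\<exists>a g. cong_elem (of_nat p) (Q f) ([:1, j:] ^ a * g) \<and> \<not> int p dvd poly g v" if f: "f \<in> A" for f
        proof -
          obtain a g where ag: "cong_elem (of_nat p) (Q f) ([:-v, 1:] ^ a * g)" "\<not> int p dvd poly g v"
            using exists_order_mod[OF prime_p nd[OF f]] by metis
          obtain c where c: "cong_elem (of_nat p) ([:-v, 1:] ^ a) ([:1, j:] ^ a * [:c:])" "\<not> int p dvd c" using v(3) by metis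
          have "cong_elem (of_nat p) (Q f) ([:1, j:] ^ a * [:c:] * g)"
            by (rule cong_elem_trans[OF ag(1) cong_elem_mult[OF c(1) cong_elem_refl]])
          then have "cong_elem (of_nat p) (Q f) ([:1, j:] ^ a * ([:c:] * g))" by (simp only: mult.assoc)
          moreover have "\<not> int p dvd poly ([:c:] * g) v" using ag(2) c(2) prime_p by (simp add: prime_dvd_mult_iff)
          ultimately show ?thesis by blast
        qed
        obtain a g where ag: "cong_elem (of_nat p) (Q e) ([:1, j:] ^ a * g)" "\<not> int p dvd poly g v"
          using ord[OF e(1)] by blast
        obtain a0 g0 where ag0: "cong_elem (of_nat p) (Q e0) ([:1, j:] ^ a0 * g0)" "\<not> int p dvd poly g0 v"
          using ord[OF e0(1)] by blast
        have p': "p = Suc (q * s)" using p_eq by simp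
        have nn: "\<not> of_nat p dvd Q e * Q e0"
          using nd[OF e(1)] nd[OF e0(1)] prime_elem_dvd_mult_iff[OF ring_p] by blast
        have "cong_elem (of_nat p) (Q e * Q' e0) (Q' e * Q e0)"
          using R e unfolding cong_elem_def R_def by blast
        moreover have "Q e * Q' e0 = (Q e * Q e0) * (Q e0 ^ (q * s) * (\<Prod>j\<in>J. [:1, j:] ^ (s * (q - 1 - e0 j))))"
          unfolding Q'_def p' by (simp add: mult_ac)
        moreover have "Q' e * Q e0 = (Q e * Q e0) * (Q e ^ (q * s) * (\<Prod>j\<in>J. [:1, j:] ^ (s * (q - 1 - e j))))"
          unfolding Q'_def p' by (simp add: mult_ac)
        ultimately have "cong_elem (of_nat p) ((Q e * Q e0) * (Q e0 ^ (q * s) * (\<Prod>j\<in>J. [:1, j:] ^ (s * (q - 1 - e0 j)))))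
             ((Q e * Q e0) * (Q e ^ (q * s) * (\<Prod>j\<in>J. [:1, j:] ^ (s * (q - 1 - e j)))))"
          by simp
        \<comment> \<open>Cancelling \<open>Q e * Q e0\<close> leaves \<open>Q e\<close> and
          \<open>Q e0\<close> with exponent \<open>p - 1 = q * s\<close>, so their orders at
          \<open>v\<close> enter as multiples of \<open>q * s\<close>.\<close>
        then have canc: "cong_elem (of_nat p) (Q e0 ^ (q * s) * (\<Prod>j\<in>J. [:1, j:] ^ (s * (q - 1 - e0 j))))
             (Q e ^ (q * s) * (\<Prod>j\<in>J. [:1, j:] ^ (s * (q - 1 - e j))))"
          by (rule cong_elem_cancel_left[OF ring_p nn])
        have expand: "cong_elem (of_nat p) (Q f ^ (q * s) * (\<Prod>j\<in>J. [:1, j:] ^ (s * (q - 1 - f j))))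
             ([:1, j:] ^ (b * (q * s) + s * (q - 1 - f j)) * (h ^ (q * s) * ?Z f))"
          if "cong_elem (of_nat p) (Q f) ([:1, j:] ^ b * h)" for f b h
        proof -
          have split: "(\<Prod>j\<in>J. [:1, j:] ^ (s * (q - 1 - f j))) = [:1, j:] ^ (s * (q - 1 - f j)) * ?Z f"
            by (rule prod.remove[OF finite_J j(1)])
          have "cong_elem (of_nat p) (Q f ^ (q * s)) (([:1, j:] ^ b * h) ^ (q * s))"
            using that by (rule cong_elem_power)
          then have "cong_elem (of_nat p) (Q f ^ (q * s) * (\<Prod>j\<in>J. [:1, j:] ^ (s * (q - 1 - f j))))
             (([:1, j:] ^ b * h) ^ (q * s) * ([:1, j:] ^ (s * (q - 1 - f j)) * ?Z f))"
            unfolding split by (rule cong_elem_mult[OF _ cong_elem_refl])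
          also have "\<dots> = [:1, j:] ^ (b * (q * s) + s * (q - 1 - f j)) * (h ^ (q * s) * ?Z f)"
            by (rule power_mult_collect)
          finally show ?thesis .
        qed
        have rel: "cong_elem (of_nat p) ([:1, j:] ^ (a0 * (q * s) + s * (q - 1 - e0 j)) * (g0 ^ (q * s) * ?Z e0))
           ([:1, j:] ^ (a * (q * s) + s * (q - 1 - e j)) * (g ^ (q * s) * ?Z e))"
          by (rule cong_elem_trans[OF cong_elem_trans[OF cong_elem_sym[OF expand[OF ag0(1)]] canc] expand[OF ag(1)]])
        have nz': "\<not> int p dvd poly (h ^ (q * s) * ?Z f) v" if "\<not> int p dvd poly h v" for h f
          using that nz[of f] prime_p unfolding poly_mult poly_power
          by (simp add: prime_dvd_mult_iff prime_elem_not_dvd_power)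
        \<comment> \<open>Equality of the two orders at \<open>v\<close>; divided by
          \<open>s\<close> and reduced modulo \<open>q\<close> it gives
          \<open>e0 j = e j\<close>.\<close>
        have "a0 * (q * s) + s * (q - 1 - e0 j) = a * (q * s) + s * (q - 1 - e j)"
          by (rule order_mod_unique[OF prime_p not_dvd_lin v(1) rel nz'[OF ag0(2)] nz'[OF ag(2)]])
        then have "s * (q - 1 - e0 j + q * a0) = s * (q - 1 - e j + q * a)" by (simp add: algebra_simps)
        moreover have "s > 0" using p_eq prime_gt_1_nat[OF prime_p] by (cases s) auto
        ultimately have "q - 1 - e0 j + q * a0 = q - 1 - e j + q * a" by simp
        then have "(q - 1 - e0 j) mod q = (q - 1 - e j) mod q" by (metis mod_mult_self2)
        moreover have "e j < q" "e0 j < q" using e(1) e0(1) psubset.prems(1) j(1) exponents_less by blast+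
        ultimately show False using j(2) q_gt_0 by simp
      qed
      with psubset.prems(2) have "of_nat p dvd fps_of_poly (Q e0) * eta_mon e0" by simp
      then show False
        using e0(2) not_dvd_eta_mon prime_elem_dvd_mult_iff[OF prime_elem_of_nat_fps[OF prime_p]]
          of_nat_dvd_fps_of_poly_iff by blast
    qed
  qed
  then show ?thesis using assms(3) by blast
qed

end

lemma degree_sum_less_bound:
  fixes f :: "'a \<Rightarrow> 'b::comm_monoid_add poly"
  assumes "\<And>x. x \<in> A \<Longrightarrow> degree (f x) < n" "0 < n"
  shows "degree (sum f A) < n"
proof (cases "finite A")
  case True
  have "degree (sum f A) \<le> n - 1"
    using True assms(1) by (intro degree_sum_le) force+
  with assms(2) show ?thesis by simp
qed (use assms(2) in simp)

context power_residue_setting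
begin

section \<open>The zero estimate\<close>

definition exp_sum :: "(int \<Rightarrow> nat) \<Rightarrow> (int \<Rightarrow> nat) \<Rightarrow> int \<Rightarrow> nat" where
  "exp_sum e e' = restrict (\<lambda>j. (e j + e' j) mod q) J"

text \<open>By \<open>eta j ^ q = 1 / (1 + j U)\<close>, an exponent sum that reaches
  \<open>q\<close> costs a factor \<open>1 / (1 + j U)\<close>, which \<open>lin_prod\<close>
  absorbs. The factors of \<open>lin_prod\<close> at the other \<open>j\<close> survive and form the
  carry.\<close>

definition carry :: "(int \<Rightarrow> nat) \<Rightarrow> (int \<Rightarrow> nat) \<Rightarrow> int poly" where
  "carry e e' = (\<Prod>j\<in>{j\<in>J. e j + e' j < q}. [:1, j:])"

definition lin_prod :: "int poly" where "lin_prod = (\<Prod>j\<in>J. [:1, j:])"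

lemma exp_sum_exponents: "exp_sum e e' \<in> exponents"
  unfolding exp_sum_def exponents_def using q_gt_0 by auto

lemma eta_mon_mult:
  assumes "e \<in> exponents" "e' \<in> exponents"
  shows "cong_elem (of_nat p) (fps_of_poly lin_prod * (eta_mon e * eta_mon e')) (fps_of_poly (carry e e') * eta_mon (exp_sum e e'))"
proof -
  have 1: "cong_elem (of_nat p) (lin_fps j * (eta j ^ e j * eta j ^ e' j))
      ((if e j + e' j < q then lin_fps j else 1) * eta j ^ exp_sum e e' j)" if j: "j \<in> J" for j
  proof (cases "e j + e' j < q")
    case True
    then show ?thesis using j by (simp add: exp_sum_def power_add)
  next
    case False
    have less: "e j < q" "e' j < q" using assms j exponents_less by blast+
    then have c: "e j + e' j = q + exp_sum e e' j" using False j by (simp add: exp_sum_def le_mod_geq)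
    have "lin_fps j * (eta j ^ e j * eta j ^ e' j) = lin_fps j * eta j ^ (q + exp_sum e e' j)"
      by (simp only: c flip: power_add)
    also have "\<dots> = (eta j ^ q * lin_fps j) * eta j ^ exp_sum e e' j"
      by (simp only: power_add mult_ac)
    finally have "lin_fps j * (eta j ^ e j * eta j ^ e' j) = (eta j ^ q * lin_fps j) * eta j ^ exp_sum e e' j" .
    moreover have "cong_elem (of_nat p) \<dots> (1 * eta j ^ exp_sum e e' j)"
      by (rule cong_elem_mult[OF eta_power_q cong_elem_refl])
    ultimately have "cong_elem (of_nat p) (lin_fps j * (eta j ^ e j * eta j ^ e' j)) (1 * eta j ^ exp_sum e e' j)"
      by (simp only:)
    then show ?thesis using False by simp
  qed
  have "fps_of_poly lin_prod * (eta_mon e * eta_mon e') = (\<Prod>j\<in>J. lin_fps j * (eta j ^ e j * eta j ^ e' j))"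
    by (simp add: lin_prod_def eta_mon_def fps_of_poly_prod lin_fps_def prod.distrib)
  moreover have "fps_of_poly (carry e e') * eta_mon (exp_sum e e') = (\<Prod>j\<in>J. (if e j + e' j < q then lin_fps j else 1) * eta j ^ exp_sum e e' j)"
    using finite_J by (simp add: carry_def eta_mon_def fps_of_poly_prod lin_fps_def prod.distrib prod.If_cases Int_def)
  ultimately show ?thesis using cong_elem_prod[OF 1] by simp
qed

lemma degree_lin_prod_le: "degree lin_prod \<le> card J"
  unfolding lin_prod_def using degree_prod_sum_le[OF finite_J, of "\<lambda>j. [:1, j:]"]
  by (rule order_trans) (use sum_bounded_above[of J "\<lambda>j. degree [:1, j:]" 1] in \<open>simp add: degree_pCons_eq_if\<close>)

lemma degree_carry_le: "degree (carry e e') \<le> card J"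
proof -
  let ?A = "{j\<in>J. e j + e' j < q}"
  have "degree (carry e e') \<le> (\<Sum>j\<in>?A. degree [:1, j:])"
    unfolding carry_def using finite_J by (intro degree_prod_sum_le[unfolded o_def, simplified o_def]) auto
  also have "\<dots> \<le> card ?A"
    using sum_bounded_above[of ?A "\<lambda>j. degree [:1, j:]" 1] by (simp add: degree_pCons_eq_if)
  also have "\<dots> \<le> card J" using finite_J by (intro card_mono) auto
  finally show ?thesis .
qed

lemma not_dvd_lin_prod: "\<not> of_nat p dvd lin_prod"
  unfolding lin_prod_def by (intro prime_elem_not_dvd_prod prime_elem_of_nat_poly prime_p not_dvd_lin)

definition poly_of_fun :: "nat \<Rightarrow> (nat \<Rightarrow> int) \<Rightarrow> int poly" where
  "poly_of_fun n f = (\<Sum>i<n. monom (f i) i)"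

lemma coeff_poly_of_fun: "coeff (poly_of_fun n f) i = (if i < n then f i else 0)"
proof -
  have "coeff (poly_of_fun n f) i = (\<Sum>k<n. if i = k then f k else 0)"
    unfolding poly_of_fun_def coeff_sum by (intro sum.cong) auto
  then show ?thesis by simp
qed

lemma poly_of_fun_diff: "poly_of_fun n (\<lambda>i. f i - g i) = poly_of_fun n f - poly_of_fun n g"
  by (intro poly_eqI) (simp add: coeff_poly_of_fun)

lemma degree_poly_of_fun_less: "0 < n \<Longrightarrow> degree (poly_of_fun n f) < n"
  unfolding poly_of_fun_def by (intro degree_sum_less_bound) (auto intro: le_less_trans[OF degree_monom_le])

text \<open>A counting argument: if \<open>G = \<Sum> P\<^sub>e \<eta>\<^sup>e\<close> vanished to order \<open>N\<close>, then \<open>(W, r) \<mapsto> G W + r\<close>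
  would embed too large a space into the combinations of the \<open>\<eta>\<^sup>e\<close> with small coefficients.\<close>

lemma zero_estimate:
  assumes deg: "\<And>e. e \<in> exponents \<Longrightarrow> degree (P e) < B" and N: "q ^ card J * (B + card J) < N"
    and van: "vanishes p N (\<Sum>e\<in>exponents. fps_of_poly (P e) * eta_mon e)" and e: "e \<in> exponents"
  shows "of_nat p dvd P e"
proof (rule ccontr)
  assume ndvd: "\<not> of_nat p dvd P e"
  define k where "k = card J"
  define n where "n = N + B + k"
  define zero where "zero = restrict (\<lambda>_. 0 :: nat) J"
  have zero: "zero \<in> exponents" unfolding zero_def exponents_def using q_gt_0 by auto
  have eta_mon0: "eta_mon zero = 1" unfolding eta_mon_def zero_def by simp
  define W where "W = (\<lambda>(x :: ((int \<Rightarrow> nat) \<times> nat) + nat \<Rightarrow> int) e'. poly_of_fun N (\<lambda>i. x (Inl (e', i))))"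
  define r where "r = (\<lambda>(x :: ((int \<Rightarrow> nat) \<times> nat) + nat \<Rightarrow> int). poly_of_fun N (\<lambda>i. x (Inr i)))"
  \<comment> \<open>\<open>H x f\<close> is the coefficient of \<open>eta_mon f\<close> in
    \<open>lin_prod * (G * V + r)\<close>, with \<open>G\<close> and \<open>V\<close> as below;
    \<open>r\<close> belongs to the monomial 1, whose exponent is \<open>zero\<close>.\<close>
  define H where "H = (\<lambda>x f. (\<Sum>(a, b)\<in>{ab\<in>exponents \<times> exponents. exp_sum (fst ab) (snd ab) = f}. P a * W x b * carry a b)
     + (if f = zero then lin_prod * r x else 0))"
  define \<phi> where "\<phi> = (\<lambda>x (f, i). coeff (H x f) i)"
  have N0: "N > 0" using N by simp
  \<comment> \<open>There are \<open>q ^ k * N + N\<close> unknowns for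
    \<open>q ^ k * (N + B + k)\<close> coefficients; the excess is the assumption on
    \<open>N\<close>.\<close>
  have card_less: "card (exponents \<times> {..<n}) < card ((exponents \<times> {..<N}) <+> {..<N})"
    using N finite_exponents by (simp add: card_Plus card_exponents card_cartesian_product n_def k_def algebra_simps)
  have diff: "\<phi> (\<lambda>a. x a - y a) c = \<phi> x c - \<phi> y c" if "c \<in> exponents \<times> {..<n}" for x y c
  proof -
    have wd: "W (\<lambda>a. x a - y a) b = W x b - W y b" for b unfolding W_def by (rule poly_of_fun_diff)
    have rd: "r (\<lambda>a. x a - y a) = r x - r y" unfolding r_def by (rule poly_of_fun_diff)
    have "H (\<lambda>a. x a - y a) f = H x f - H y f" for f
      unfolding H_def wd rd by (simp add: case_prod_beta algebra_simps sum_subtractf)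
    then show ?thesis unfolding \<phi>_def by (simp add: case_prod_beta)
  qed
  obtain x where x: "\<exists>a\<in>(exponents \<times> {..<N}) <+> {..<N}. \<not> int p dvd x a"
      "\<And>c. c \<in> exponents \<times> {..<n} \<Longrightarrow> int p dvd \<phi> x c"
    by (rule exists_nontrivial_solution_mod[where \<phi> = \<phi>, OF prime_gt_1_nat[OF prime_p] _ _ card_less diff])
      (use finite_exponents in auto)
  have degH: "degree (H x f) < n" for f
  proof -
    have W: "degree (W x b) < N" for b unfolding W_def by (rule degree_poly_of_fun_less[OF N0])
    have r: "degree (r x) < N" unfolding r_def by (rule degree_poly_of_fun_less[OF N0])
    have "degree (P a * W x b * carry a b) < n" if "a \<in> exponents" for a b
      using degree_mult_le[of "P a * W x b" "carry a b"] degree_mult_le[of "P a" "W x b"]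
        deg[OF that] W[of b] degree_carry_le[of a b] unfolding n_def k_def by linarith
    moreover have "degree (lin_prod * r x) < n"
      using degree_mult_le[of lin_prod "r x"] degree_lin_prod_le r unfolding n_def k_def by linarith
    moreover have "n > 0" using N0 by (simp add: n_def)
    ultimately show ?thesis
      unfolding H_def by (intro degree_add_less degree_sum_less_bound) auto
  qed
  have pH: "of_nat p dvd H x f" if "f \<in> exponents" for f
    unfolding of_nat_dvd_poly_iff
  proof
    fix i
    show "int p dvd coeff (H x f) i"
    proof (cases "i < n")
      case True
      then show ?thesis using x(2)[of "(f, i)"] that by (simp add: \<phi>_def)
    next
      case False
      then show ?thesis using degH[of f] by (simp add: coeff_eq_0)
    qed
  qed
  define G where "G = (\<Sum>e\<in>exponents. fps_of_poly (P e) * eta_mon e)"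
  define V where "V = (\<Sum>e\<in>exponents. fps_of_poly (W x e) * eta_mon e)"
  have "(\<Sum>f\<in>exponents. fps_of_poly (H x f) * eta_mon f) =
      (\<Sum>f\<in>exponents. \<Sum>(a, b)\<in>{ab\<in>exponents \<times> exponents. exp_sum (fst ab) (snd ab) = f}.
          fps_of_poly (P a * W x b) * (fps_of_poly (carry a b) * eta_mon (exp_sum a b)))
      + fps_of_poly (lin_prod * r x)"
  proof -
    have "(\<Sum>f\<in>exponents. fps_of_poly (if f = zero then lin_prod * r x else 0) * eta_mon f) = fps_of_poly (lin_prod * r x)"
      using zero finite_exponents eta_mon0 by (subst sum.remove[of _ zero]) auto
    then show ?thesis
      unfolding H_def fps_of_poly_add distrib_right sum.distrib fps_of_poly_sum sum_distrib_right
      by (simp add: case_prod_beta fps_of_poly_mult mult.assoc)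
  qed
  also have "\<dots> = (\<Sum>(a, b)\<in>exponents \<times> exponents. fps_of_poly (P a * W x b) * (fps_of_poly (carry a b) * eta_mon (exp_sum a b)))
      + fps_of_poly (lin_prod * r x)"
    using finite_exponents exp_sum_exponents by (subst sum.group) auto
  finally have sum_H: "(\<Sum>f\<in>exponents. fps_of_poly (H x f) * eta_mon f) = \<dots>" .
  have "fps_of_poly lin_prod * (G * V + fps_of_poly (r x)) =
      (\<Sum>(a, b)\<in>exponents \<times> exponents. fps_of_poly (P a * W x b) * (fps_of_poly lin_prod * (eta_mon a * eta_mon b)))
      + fps_of_poly (lin_prod * r x)"
    unfolding G_def V_def sum_product sum.cartesian_product
    by (simp add: distrib_left sum_distrib_left case_prod_beta fps_of_poly_mult mult_ac)
  then have "cong_elem (of_nat p) (\<Sum>f\<in>exponents. fps_of_poly (H x f) * eta_mon f) (fps_of_poly lin_prod * (G * V + fps_of_poly (r x)))"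
    unfolding sum_H
    by (simp only:) (intro cong_elem_add cong_elem_sum cong_elem_refl, auto intro!: cong_elem_mult[OF cong_elem_refl cong_elem_sym[OF eta_mon_mult]])
  moreover have "of_nat p dvd (\<Sum>f\<in>exponents. fps_of_poly (H x f) * eta_mon f)"
    using pH by (intro dvd_sum dvd_mult2) (simp add: of_nat_dvd_fps_of_poly_iff)
  ultimately have "of_nat p dvd fps_of_poly lin_prod * (G * V + fps_of_poly (r x))"
    using cong_elem_dvd_iff by blast
  then have GVr: "of_nat p dvd G * V + fps_of_poly (r x)"
    using not_dvd_lin_prod prime_elem_dvd_mult_iff[OF prime_elem_of_nat_fps[OF prime_p]]
      of_nat_dvd_fps_of_poly_iff by blast
  \<comment> \<open>As \<open>G\<close> vanishes to order \<open>N\<close>, so does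
    \<open>r\<close>, whose degree is below \<open>N\<close>. Hence \<open>r = 0\<close> and
    \<open>G * V = 0\<close> modulo \<open>p\<close>; linear independence makes \<open>G\<close>
    nonzero and then every \<open>W x b\<close> zero, against the nontrivial choice of
    \<open>x\<close>.\<close>
  have "vanishes p N ((G * V + fps_of_poly (r x)) - G * V)"
    using van[folded G_def] by (intro vanishes_diff vanishes_mult vanishes_of_nat_dvd[OF GVr])
  then have rx: "int p dvd x (Inr i)" if "i < N" for i
    using that by (simp add: vanishes_def r_def coeff_poly_of_fun)
  then have "of_nat p dvd fps_of_poly (r x)"
    unfolding of_nat_dvd_fps_of_poly_iff of_nat_dvd_poly_iff by (simp add: r_def coeff_poly_of_fun)
  with GVr have "of_nat p dvd G * V" by (metis dvd_add_left_iff)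
  moreover have "\<not> of_nat p dvd G"
    using linear_independence[OF order_refl _ e] ndvd unfolding G_def by blast
  ultimately have "of_nat p dvd V"
    using prime_elem_dvd_mult_iff[OF prime_elem_of_nat_fps[OF prime_p]] by blast
  then have "of_nat p dvd W x b" if "b \<in> exponents" for b
    using linear_independence[OF order_refl _ that] unfolding V_def by blast
  then have "int p dvd x (Inl (b, i))" if "b \<in> exponents" "i < N" for b i
    using that unfolding of_nat_dvd_poly_iff W_def by (metis coeff_poly_of_fun)
  with x(1) rx show False by auto
qed

text \<open>The zero estimate with \<open>N = p\<close>, the order to which \<open>lin_mon e\<close>
  and \<open>eta_mon e\<close> agree.\<close>

lemma lin_mon_zero_estimate:
  assumes deg: "\<And>e. e \<in> exponents \<Longrightarrow> degree (P e) < B" and N: "q ^ card J * (B + card J) < p"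
    and van: "vanishes p p (fps_of_poly (\<Sum>e\<in>exponents. P e * lin_mon e))" and e: "e \<in> exponents"
  shows "of_nat p dvd P e"
proof (rule zero_estimate[OF deg N _ e])
  have "vanishes p p (\<Sum>e\<in>exponents. fps_of_poly (P e) * (eta_mon e - fps_of_poly (lin_mon e)))"
    by (intro vanishes_sum vanishes_mult_left vanishes_eta_mon_lin_mon)
  from vanishes_add[OF this van]
  show "vanishes p p (\<Sum>e\<in>exponents. fps_of_poly (P e) * eta_mon e)"
    by (simp add: fps_of_poly_sum fps_of_poly_mult right_diff_distrib sum_subtractf)
qed

end

section \<open>Stepanov's method\<close>

lemma cong_elem_pderiv: "cong_elem (of_nat p) f g \<Longrightarrow> cong_elem (of_nat p) (pderiv f) (pderiv (g :: int poly))"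
  unfolding cong_elem_def pderiv_diff [symmetric] by (simp add: of_nat_dvd_poly_iff coeff_pderiv)

lemma cong_elem_funpow_pderiv: "cong_elem (of_nat p) f g \<Longrightarrow> cong_elem (of_nat p) ((pderiv ^^ n) f) ((pderiv ^^ n) (g :: int poly))"
  by (induction n) (auto intro: cong_elem_pderiv)

lemma smult_of_nat_poly: "Polynomial.smult (of_nat n) f = of_nat n * f"
  for f :: "'a::comm_semiring_1 poly"
  by (simp add: of_nat_poly)

lemma pderiv_sum: "pderiv (sum f A) = (\<Sum>x\<in>A. pderiv (f x))"
  by (induction A rule: infinite_finite_induct) (simp_all add: pderiv_add)

lemma funpow_pderiv_sum: "(pderiv ^^ n) (sum f A) = (\<Sum>x\<in>A. (pderiv ^^ n) (f x))"
  by (induction n) (simp_all add: pderiv_sum)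

lemma poly_funpow_pderiv_factor: "poly ((pderiv ^^ n) ([:-u, 1:] ^ n * h)) u = fact n * poly h (u :: int)"
proof (induction n arbitrary: h)
  case (Suc n)
  have "pderiv ([:-u, 1:] ^ Suc n * h) = [:-u, 1:] ^ n * (of_nat (Suc n) * h + [:-u, 1:] * pderiv h)"
    unfolding pderiv_mult pderiv_power_Suc smult_of_nat_poly
    by (simp add: pderiv_pCons algebra_simps del: mult_pCons_left mult_pCons_right flip: one_pCons)
  then have "(pderiv ^^ Suc n) ([:-u, 1:] ^ Suc n * h)
      = (pderiv ^^ n) ([:-u, 1:] ^ n * (of_nat (Suc n) * h + [:-u, 1:] * pderiv h))"
    by (simp only: funpow_Suc_right o_def)
  also have "poly \<dots> u = fact n * poly (of_nat (Suc n) * h + [:-u, 1:] * pderiv h) u"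
    by (rule Suc.IH)
  finally show ?case by (simp add: poly_of_nat algebra_simps del: of_nat_Suc)
qed simp

text \<open>Derivatives detect multiplicity here because only factorials of numbers below
  \<open>D \<le> p\<close> occur, and these are prime to \<open>p\<close>.\<close>

lemma root_multiplicity_mod:
  fixes f :: "int poly"
  assumes "prime p" "D \<le> p" "\<And>n. n < D \<Longrightarrow> int p dvd poly ((pderiv ^^ n) f) u"
  shows "\<exists>h. cong_elem (of_nat p) f ([:-u, 1:] ^ D * h)"
  using assms(2,3)
proof (induction D)
  case 0
  show ?case by (intro exI[of _ f]) simp
next
  case (Suc D)
  then obtain h where h: "cong_elem (of_nat p) f ([:-u, 1:] ^ D * h)" by auto
  have "cong_elem (int p) (poly ((pderiv ^^ D) f) u) (poly ((pderiv ^^ D) ([:-u, 1:] ^ D * h)) u)"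
    by (intro cong_elem_poly cong_elem_funpow_pderiv h)
  then have "int p dvd fact D * poly h u"
    unfolding poly_funpow_pderiv_factor using Suc.prems(2)[of D] by (simp add: cong_elem_dvd_iff)
  moreover have "\<not> p dvd fact D" using Suc.prems(1) assms(1) by (simp add: prime_dvd_fact_iff)
  then have "\<not> int p dvd fact D" by (metis of_nat_dvd_iff of_nat_fact)
  ultimately have hu: "int p dvd poly h u" using assms(1) by (simp add: prime_dvd_mult_iff)
  have "h = [:-u, 1:] * synthetic_div h u + [:poly h u:]"
    by (rule synthetic_div_correct'[symmetric])
  moreover have "cong_elem (of_nat p) \<dots> ([:-u, 1:] * synthetic_div h u + 0)"
    using hu by (intro cong_elem_add cong_elem_refl) (simp add: cong_elem_0_iff of_nat_poly)
  ultimately have "cong_elem (of_nat p) h ([:-u, 1:] * synthetic_div h u)" by simp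
  from cong_elem_trans[OF h cong_elem_mult[OF cong_elem_refl this]]
  have "cong_elem (of_nat p) f ([:-u, 1:] ^ Suc D * synthetic_div h u)"
    by (simp only: power_Suc2 mult.assoc)
  then show ?case by blast
qed

lemma not_dvd_monic_linear:
  assumes "prime p" shows "\<not> of_nat p dvd [:-u, 1 :: int:]"
proof
  assume "of_nat p dvd [:-u, 1 :: int:]"
  then have "int p dvd coeff [:-u, 1 :: int:] 1" unfolding of_nat_dvd_poly_iff by blast
  then show False using prime_gt_1_nat[OF assms] by simp
qed

text \<open>The product over the earlier roots does not vanish at a new root \<open>u\<close>, so
  the whole order of \<open>f\<close> at \<open>u\<close> is carried by the cofactor
  \<open>g\<close>.\<close>

lemma prod_roots_mod:
  fixes f :: "int poly"
  assumes "prime p" "\<not> of_nat p dvd f" "finite S" "S \<subseteq> {0..<int p}"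
    and "\<And>u. u \<in> S \<Longrightarrow> \<exists>h. cong_elem (of_nat p) f ([:-u, 1:] ^ D * h)"
  shows "\<exists>g. cong_elem (of_nat p) f ((\<Prod>u\<in>S. [:-u, 1:] ^ D) * g)"
  using assms(3-5)
proof (induction S rule: finite_induct)
  case empty
  show ?case by (intro exI[of _ f]) simp
next
  case (insert u S)
  let ?P = "\<Prod>u\<in>S. [:-u, 1:] ^ D"
  from insert obtain g where g: "cong_elem (of_nat p) f (?P * g)" by auto
  from insert.prems obtain h where h: "cong_elem (of_nat p) f ([:-u, 1:] ^ D * h)" by blast
  have "\<not> of_nat p dvd g" using cong_elem_dvd_iff[OF g] assms(2) dvd_mult by blast
  then obtain a A where A: "cong_elem (of_nat p) g ([:-u, 1:] ^ a * A)" "\<not> int p dvd poly A u"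
    using exists_order_mod[OF assms(1)] by blast
  have "\<not> of_nat p dvd h" using cong_elem_dvd_iff[OF h] assms(2) dvd_mult by blast
  then obtain b C where C: "cong_elem (of_nat p) h ([:-u, 1:] ^ b * C)" "\<not> int p dvd poly C u"
    using exists_order_mod[OF assms(1)] by blast
  have 1: "cong_elem (of_nat p) f ([:-u, 1:] ^ (D + b) * C)"
    using cong_elem_trans[OF h cong_elem_mult[OF cong_elem_refl C(1)]] by (simp only: power_add mult.assoc)
  have 2: "cong_elem (of_nat p) f ([:-u, 1:] ^ a * (?P * A))"
    using cong_elem_trans[OF g cong_elem_mult[OF cong_elem_refl A(1)]] by (simp only: mult.left_commute)
  have "\<not> int p dvd u - v" if "v \<in> S" for v
  proof
    assume "int p dvd u - v"
    moreover have "0 \<le> u" "u < int p" "0 \<le> v" "v < int p" using insert.prems that by auto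
    ultimately have "u = v" by (metis mod_eq_dvd_iff mod_pos_pos_trivial)
    then show False using insert.hyps that by simp
  qed
  then have "\<not> int p dvd poly ?P u"
    unfolding poly_prod poly_power using assms(1)
    by (intro prime_elem_not_dvd_prod prime_elem_not_dvd_power) auto
  then have "\<not> int p dvd poly (?P * A) u" using A(2) assms(1) by (simp add: prime_dvd_mult_iff)
  then have "a = D + b"
    using order_mod_unique[OF assms(1) not_dvd_monic_linear[OF assms(1)] _ cong_elem_trans[OF cong_elem_sym[OF 2] 1] _ C(2)]
    by simp
  then have "cong_elem (of_nat p) f ((\<Prod>u\<in>insert u S. [:-u, 1:] ^ D) * ([:-u, 1:] ^ b * A))"
    using 2 unfolding prod.insert[OF insert.hyps(1,2)] by (simp only: power_add mult_ac)
  then show ?case by blast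
qed

lemma card_roots_mod_le:
  fixes f :: "int poly"
  assumes "prime p" "\<not> of_nat p dvd f" "finite S" "S \<subseteq> {0..<int p}"
    and "\<And>u. u \<in> S \<Longrightarrow> \<exists>h. cong_elem (of_nat p) f ([:-u, 1:] ^ D * h)"
  shows "D * card S \<le> degree f"
proof -
  let ?P = "\<Prod>u\<in>S. [:-u, 1:] ^ D"
  obtain g where g: "cong_elem (of_nat p) f (?P * g)" using prod_roots_mod[OF assms] by blast
  \<comment> \<open>Reduced coefficients make the leading coefficient of the cofactor prime to
    \<open>p\<close>, so that no degree is lost modulo \<open>p\<close>.\<close>
  define g' where "g' = map_poly (\<lambda>c. c mod int p) g"
  have cg': "coeff g' n = coeff g n mod int p" for n by (simp add: g'_def coeff_map_poly)
  have gg': "cong_elem (of_nat p) g g'"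
    unfolding cong_elem_def of_nat_dvd_poly_iff by (simp add: cg' minus_mod_eq_mult_div)
  have fg': "cong_elem (of_nat p) f (?P * g')"
    by (rule cong_elem_trans[OF g cong_elem_mult[OF cong_elem_refl gg']])
  have "g' \<noteq> 0" using cong_elem_dvd_iff[OF fg'] assms(2) by auto
  then have "coeff g (degree g') mod int p \<noteq> 0" using cg' by (metis leading_coeff_0_iff)
  then have lc: "\<not> int p dvd lead_coeff g'" using cg' by (metis dvd_imp_mod_0 mod_mod_trivial)
  have "lead_coeff (?P * g') = lead_coeff g'" by (simp add: lead_coeff_mult lead_coeff_prod lead_coeff_power)
  moreover have "int p dvd coeff f (degree (?P * g')) - coeff (?P * g') (degree (?P * g'))"
    using fg' unfolding cong_elem_def of_nat_dvd_poly_iff by simp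
  ultimately have "coeff f (degree (?P * g')) \<noteq> 0"
    using lc by (metis dvd_minus_iff diff_0)
  then have "degree (?P * g') \<le> degree f" by (rule le_degree)
  moreover have "degree (?P * g') = degree ?P + degree g'"
    using \<open>g' \<noteq> 0\<close> assms(3) by (intro degree_mult_eq) auto
  moreover have "degree ?P = D * card S"
    by (subst degree_prod_eq_sum_degree) (auto simp: degree_linear_power)
  ultimately show ?thesis by simp
qed

lemma power_prime_cong_self:
  assumes "prime p"
  shows "cong_elem (int p) (int n ^ p) (int n)"
proof (induction n)
  case 0
  then show ?case using prime_gt_0_nat[OF assms] by (simp add: zero_power)
next
  case (Suc n)
  have "cong_elem (int p) ((1 + int n) ^ p) (1 ^ p + int n ^ p)"
    using freshman_dream_mod[OF assms, of "1 :: int" "int n"] by simp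
  also have "cong_elem (int p) (1 ^ p + int n ^ p) (1 + int n)"
    by (intro cong_elem_add Suc) simp
  finally show ?case by simp
qed

section \<open>Derivatives of polynomial multiples of \<open>lin_mon\<close>\<close>

context power_residue_setting
begin

text \<open>\<open>s\<close> times this polynomial, divided by \<open>lin_prod\<close>, is the
  logarithmic derivative of \<open>lin_mon e\<close>.\<close>

definition log_deriv_num :: "(int \<Rightarrow> nat) \<Rightarrow> int poly" where
  "log_deriv_num e = (\<Sum>i\<in>J. of_nat (e i) * [:i:] * (\<Prod>j\<in>J-{i}. [:1, j:]))"

lemma lin_prod_pderiv_lin_mon: "lin_prod * pderiv (lin_mon e) = of_nat s * log_deriv_num e * lin_mon e"
proof -
  have "lin_prod * ((\<Prod>j\<in>J-{i}. [:1, j:] ^ (s * e j)) * pderiv ([:1, i:] ^ (s * e i)))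
      = of_nat s * (of_nat (e i) * [:i:] * (\<Prod>j\<in>J-{i}. [:1, j:])) * lin_mon e" if i: "i \<in> J" for i
  proof -
    have 1: "lin_prod = [:1, i:] * (\<Prod>j\<in>J-{i}. [:1, j:])" unfolding lin_prod_def by (rule prod.remove[OF finite_J i])
    have 2: "lin_mon e = [:1, i:] ^ (s * e i) * (\<Prod>j\<in>J-{i}. [:1, j:] ^ (s * e j))"
      unfolding lin_mon_def by (rule prod.remove[OF finite_J i])
    have 3: "[:1, i:] * pderiv ([:1, i:] ^ n) = of_nat n * [:i:] * [:1, i:] ^ n" for n
    proof (cases n)
      case (Suc m)
      have "pderiv [:1, i:] = [:i:]" by (simp add: pderiv_pCons)
      then show ?thesis unfolding Suc pderiv_power_Suc smult_of_nat_poly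
        by (simp only: power_Suc mult_ac)
    qed simp
    have "lin_prod * ((\<Prod>j\<in>J-{i}. [:1, j:] ^ (s * e j)) * pderiv ([:1, i:] ^ (s * e i)))
       = ([:1, i:] * pderiv ([:1, i:] ^ (s * e i))) * ((\<Prod>j\<in>J-{i}. [:1, j:]) * (\<Prod>j\<in>J-{i}. [:1, j:] ^ (s * e j)))"
      unfolding 1 by (simp only: mult_ac)
    also have "\<dots> = of_nat s * (of_nat (e i) * [:i:] * (\<Prod>j\<in>J-{i}. [:1, j:])) * lin_mon e"
      unfolding 3 2 of_nat_mult by (simp only: mult_ac)
    finally show ?thesis .
  qed
  then show ?thesis
    unfolding lin_mon_def pderiv_prod sum_distrib_left log_deriv_num_def sum_distrib_right
    unfolding lin_mon_def [symmetric] by (intro sum.cong) auto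
qed

text \<open>The recursion is the \<open>n\<close>-th derivative of \<open>Q * lin_mon e\<close>, divided by \<open>lin_mon e\<close> and
  multiplied by \<open>lin_prod ^ n\<close> to stay among the polynomials.\<close>

primrec twisted_deriv :: "(int \<Rightarrow> nat) \<Rightarrow> nat \<Rightarrow> int poly \<Rightarrow> int poly" where
  "twisted_deriv e 0 Q = Q"
| "twisted_deriv e (Suc n) Q = lin_prod * pderiv (twisted_deriv e n Q) + (of_nat s * log_deriv_num e - of_nat n * pderiv lin_prod) * twisted_deriv e n Q"

lemma twisted_deriv_correct: "lin_prod ^ n * (pderiv ^^ n) (Q * lin_mon e) = lin_mon e * twisted_deriv e n Q"
proof (induction n)
  case (Suc n)
  define g where "g = (pderiv ^^ n) (Q * lin_mon e)"
  define t where "t = twisted_deriv e n Q"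
  have IH: "lin_prod ^ n * g = lin_mon e * t" using Suc unfolding g_def t_def .
  have 1: "lin_prod * pderiv (lin_prod ^ n) = of_nat n * pderiv lin_prod * lin_prod ^ n"
  proof (cases n)
    case (Suc m)
    then show ?thesis unfolding Suc pderiv_power_Suc smult_of_nat_poly by (simp only: power_Suc mult_ac)
  qed simp
  have "lin_prod * pderiv (lin_prod ^ n * g) = lin_prod ^ Suc n * pderiv g + (lin_prod * pderiv (lin_prod ^ n)) * g"
    by (simp add: pderiv_mult algebra_simps)
  also have "\<dots> = lin_prod ^ Suc n * pderiv g + of_nat n * pderiv lin_prod * (lin_prod ^ n * g)"
    unfolding 1 by (simp only: mult_ac)
  finally have L: "lin_prod * pderiv (lin_mon e * t) = lin_prod ^ Suc n * pderiv g + of_nat n * pderiv lin_prod * (lin_mon e * t)"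
    unfolding IH .
  have "lin_prod * pderiv (lin_mon e * t) = lin_mon e * (lin_prod * pderiv t) + (lin_prod * pderiv (lin_mon e)) * t"
    by (simp add: pderiv_mult algebra_simps)
  also have "\<dots> = lin_mon e * (lin_prod * pderiv t) + of_nat s * log_deriv_num e * lin_mon e * t"
    unfolding lin_prod_pderiv_lin_mon ..
  finally have "lin_prod ^ Suc n * pderiv g = lin_mon e * (lin_prod * pderiv t + (of_nat s * log_deriv_num e - of_nat n * pderiv lin_prod) * t)"
    using L by (simp add: algebra_simps)
  then show ?case by (simp add: g_def t_def)
qed simp

lemma twisted_deriv_diff: "twisted_deriv e n (Q - R) = twisted_deriv e n Q - twisted_deriv e n R"
proof (induction n)
  case (Suc n)
  show ?case unfolding twisted_deriv.simps Suc pderiv_diff by (simp add: algebra_simps)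
qed simp

lemma twisted_deriv_sum: "twisted_deriv e n (sum f A) = (\<Sum>x\<in>A. twisted_deriv e n (f x))"
proof (induction n)
  case (Suc n)
  show ?case unfolding twisted_deriv.simps Suc pderiv_sum by (simp add: sum.distrib sum_distrib_left)
qed simp

text \<open>The derivative of \<open>U ^ (p * i)\<close> is zero modulo \<open>p\<close>, so this
  factor behaves like a constant.\<close>

lemma twisted_deriv_monom: "cong_elem (of_nat p) (twisted_deriv e n (monom 1 (p * i) * Q)) (monom 1 (p * i) * twisted_deriv e n Q)"
proof (induction n)
  case (Suc n)
  let ?X = "monom 1 (p * i) :: int poly" and ?t = "twisted_deriv e n Q"
  have "cong_elem (of_nat p) (pderiv ?X * ?t) (0 * ?t)"
    by (intro cong_elem_mult cong_elem_refl) (simp add: cong_elem_0_iff pderiv_monom of_nat_dvd_poly_iff)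
  then have "cong_elem (of_nat p) (?X * pderiv ?t + pderiv ?X * ?t) (?X * pderiv ?t + 0)"
    by (intro cong_elem_add cong_elem_refl) simp
  then have "cong_elem (of_nat p) (pderiv (?X * ?t)) (?X * pderiv ?t)"
    by (simp add: pderiv_mult mult.commute add.commute)
  with Suc have "cong_elem (of_nat p) (pderiv (twisted_deriv e n (?X * Q))) (?X * pderiv ?t)"
    by (blast intro: cong_elem_trans cong_elem_pderiv)
  then have "cong_elem (of_nat p) (twisted_deriv e (Suc n) (?X * Q))
     (lin_prod * (?X * pderiv ?t) + (of_nat s * log_deriv_num e - of_nat n * pderiv lin_prod) * (?X * ?t))"
    unfolding twisted_deriv.simps by (intro cong_elem_add cong_elem_mult cong_elem_refl Suc)
  then show ?case by (simp add: algebra_simps)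
qed simp

lemma degree_log_deriv_num_le: "degree (log_deriv_num e) \<le> card J - 1"
  unfolding log_deriv_num_def
proof (rule degree_sum_le[OF finite_J])
  fix i assume i: "i \<in> J"
  have "degree (\<Prod>j\<in>J-{i}. [:1, j:]) \<le> (\<Sum>j\<in>J-{i}. degree [:1, j:])"
    using degree_prod_sum_le[of "J-{i}" "\<lambda>j. [:1, j:]"] finite_J by (simp add: o_def)
  also have "\<dots> \<le> card (J - {i})"
    using sum_bounded_above[of "J-{i}" "\<lambda>j. degree [:1, j:]" 1] by (simp add: degree_pCons_eq_if)
  also have "\<dots> = card J - 1" using i finite_J by simp
  finally show "degree (of_nat (e i) * [:i:] * (\<Prod>j\<in>J-{i}. [:1, j:])) \<le> card J - 1"
    using degree_mult_le[of "of_nat (e i) * [:i:]" "\<Prod>j\<in>J-{i}. [:1, j:]"] degree_mult_le[of "of_nat (e i)" "[:i:]"]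
    by (simp add: degree_of_nat)
qed

lemma degree_twisted_deriv_le:
  assumes "card J > 0"
  shows "degree (twisted_deriv e n Q) \<le> degree Q + n * (card J - 1)"
proof (induction n)
  case (Suc n)
  let ?t = "twisted_deriv e n Q"
  have "degree (lin_prod * pderiv ?t) \<le> degree ?t + (card J - 1)"
  proof (cases "degree ?t = 0")
    case True
    then show ?thesis by (auto elim: degree_eq_zeroE)
  next
    case False
    then show ?thesis using degree_mult_le[of lin_prod "pderiv ?t"] degree_lin_prod_le degree_pderiv[of ?t] assms by linarith
  qed
  moreover have "degree (of_nat s * log_deriv_num e - of_nat n * pderiv lin_prod) \<le> card J - 1"
    using degree_mult_le[of "of_nat s" "log_deriv_num e"] degree_mult_le[of "of_nat n" "pderiv lin_prod"] degree_log_deriv_num_le[of e]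
      degree_pderiv[of lin_prod] degree_lin_prod_le
    by (intro degree_diff_le) (auto simp: degree_of_nat)
  then have "degree ((of_nat s * log_deriv_num e - of_nat n * pderiv lin_prod) * ?t) \<le> (card J - 1) + degree ?t"
    using degree_mult_le[of "of_nat s * log_deriv_num e - of_nat n * pderiv lin_prod" ?t] by linarith
  ultimately have "degree (twisted_deriv e (Suc n) Q) \<le> degree ?t + (card J - 1)"
    unfolding twisted_deriv.simps by (intro degree_add_le) auto
  then show ?case using Suc by simp
qed simp

section \<open>The auxiliary polynomial\<close>

definition residue_set :: "int set" where
  "residue_set = {u \<in> {0..<int p}. \<forall>j\<in>J. int p dvd (1 + j * u) ^ s - 1}"

text \<open>At points of the set, \<open>U ^ p = U\<close> and each \<open>lin_mon e\<close> is 1,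
  so \<open>lin_prod ^ n\<close> times the \<open>n\<close>-th derivative of \<open>\<Psi>\<close>
  takes the values of a polynomial \<open>R x n\<close> of small degree. By \<open>count\<close> the
  coefficients of \<open>\<Psi>\<close> can be chosen so that all \<open>R x n\<close> with
  \<open>n < D\<close> vanish, \<open>small\<close> keeps \<open>\<Psi>\<close> nonzero, and its
  zeros of order \<open>D\<close> are counted against its degree.\<close>

theorem card_residue_set_le:
  assumes k: "card J > 0" and D: "D \<le> p" and m: "m > 0" and B: "B > 0"
    and small: "q ^ card J * (B + card J) < p"
    and count: "(\<Sum>n<D. B + m + n * (card J - 1)) < q ^ card J * m * B"
  shows "D * card residue_set \<le> p * (m - 1) + (B - 1) + s * (q - 1) * card J"
proof -
  define k where "k = card J"
  have p1: "p > 1" by (rule prime_gt_1_nat[OF prime_p])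
  let ?A = "exponents \<times> {..<m} \<times> {..<B}" and ?C = "SIGMA n:{..<D}. {..<B + m + n * (k - 1)}"
  define P where "P = (\<lambda>(x :: (int \<Rightarrow> nat) \<times> nat \<times> nat \<Rightarrow> int) e i. poly_of_fun B (\<lambda>l. x (e, i, l)))"
  define R where "R = (\<lambda>x n. \<Sum>e\<in>exponents. \<Sum>i<m. monom 1 i * twisted_deriv e n (P x e i))"
  define \<phi> where "\<phi> = (\<lambda>x (n, l). coeff (R x n) l)"
  have "card ?C = (\<Sum>n<D. B + m + n * (k - 1))" by simp
  moreover have "card ?A = q ^ card J * m * B" by (simp add: card_cartesian_product card_exponents)
  ultimately have card_less: "card ?C < card ?A" using count by (simp add: k_def)
  have diff: "\<phi> (\<lambda>a. x a - y a) c = \<phi> x c - \<phi> y c" if "c \<in> ?C" for x y c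
  proof -
    have Pd: "P (\<lambda>a. x a - y a) e i = P x e i - P y e i" for e i unfolding P_def by (rule poly_of_fun_diff)
    have "R (\<lambda>a. x a - y a) n = R x n - R y n" for n
      unfolding R_def Pd twisted_deriv_diff by (simp add: right_diff_distrib sum_subtractf)
    then show ?thesis unfolding \<phi>_def by (simp add: case_prod_beta)
  qed
  obtain x where x: "\<exists>a\<in>?A. \<not> int p dvd x a" "\<And>c. c \<in> ?C \<Longrightarrow> int p dvd \<phi> x c"
    by (rule exists_nontrivial_solution_mod[where \<phi> = \<phi>, OF p1 _ _ card_less diff])
      (use finite_exponents in auto)
  have degP: "degree (P x e i) < B" for e i unfolding P_def by (rule degree_poly_of_fun_less[OF B])
  have degR: "degree (R x n) < B + m + n * (k - 1)" for n
  proof -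
    have "degree (monom 1 i * twisted_deriv e n (P x e i)) < B + m + n * (k - 1)" if "i < m" for e i
      using degree_mult_le[of "monom 1 i" "twisted_deriv e n (P x e i)"] degree_monom_le[of "1::int" i]
        degree_twisted_deriv_le[OF k, of e n "P x e i"] degP[of e i] that unfolding k_def by linarith
    then show ?thesis unfolding R_def using B by (intro degree_sum_less_bound) auto
  qed
  have pR: "of_nat p dvd R x n" if "n < D" for n
    unfolding of_nat_dvd_poly_iff
  proof
    fix l show "int p dvd coeff (R x n) l"
    proof (cases "l < B + m + n * (k - 1)")
      case True
      then show ?thesis using x(2)[of "(n, l)"] that by (simp add: \<phi>_def)
    next
      case False
      then show ?thesis using degR[of n] by (simp add: coeff_eq_0)
    qed
  qed
  define G where "G i = (\<Sum>e\<in>exponents. P x e i * lin_mon e)" for i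
  define \<Psi> where "\<Psi> = (\<Sum>i<m. monom 1 (p * i) * G i)"
  \<comment> \<open>The coefficients of \<open>\<Psi>\<close> from \<open>p * i\<close> to
    \<open>p * i + p - 1\<close> involve only \<open>G i'\<close> with \<open>i' \<le> i\<close>.
    The earlier ones vanish by induction, so \<open>G i\<close> vanishes to order \<open>p\<close>
    and the zero estimate applies.\<close>
  have nonzero: "\<not> of_nat p dvd \<Psi>"
  proof
    assume \<Psi>: "of_nat p dvd \<Psi>"
    have "\<forall>e\<in>exponents. of_nat p dvd P x e i" if "i < m" for i
      using that
    proof (induction i rule: less_induct)
      case (less i)
      have "int p dvd coeff (G i) n" if n: "n < p" for n
      proof -
        have "coeff \<Psi> (p * i + n) = (\<Sum>i'<m. coeff (monom 1 (p * i') * G i') (p * i + n))"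
          unfolding \<Psi>_def coeff_sum ..
        also have "\<dots> = coeff (monom 1 (p * i) * G i) (p * i + n) + (\<Sum>i'\<in>{..<m}-{i}. coeff (monom 1 (p * i') * G i') (p * i + n))"
          using less.prems by (subst sum.remove[of _ i]) auto
        also have "coeff (monom 1 (p * i) * G i) (p * i + n) = coeff (G i) n"
          by (simp add: coeff_monom_mult)
        finally have eq: "coeff \<Psi> (p * i + n) = coeff (G i) n + (\<Sum>i'\<in>{..<m}-{i}. coeff (monom 1 (p * i') * G i') (p * i + n))" .
        have "int p dvd (\<Sum>i'\<in>{..<m}-{i}. coeff (monom 1 (p * i') * G i') (p * i + n))"
        proof (rule dvd_sum)
          fix i' assume i': "i' \<in> {..<m} - {i}"
          show "int p dvd coeff (monom 1 (p * i') * G i') (p * i + n)"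
          proof (cases "i' < i")
            case True
            with less i' have "of_nat p dvd G i'" unfolding G_def by (intro dvd_sum dvd_mult2) auto
            then have "of_nat p dvd monom 1 (p * i') * G i'" by (rule dvd_mult)
            then show ?thesis unfolding of_nat_dvd_poly_iff by blast
          next
            case False
            with i' have "i + 1 \<le> i'" by auto
            then have "p * (i + 1) \<le> p * i'" by (rule mult_le_mono2)
            then have "p * i + n < p * i'" using n by simp
            then show ?thesis by (simp add: coeff_monom_mult)
          qed
        qed
        moreover have "int p dvd coeff \<Psi> (p * i + n)" using \<Psi> unfolding of_nat_dvd_poly_iff by blast
        ultimately show ?thesis unfolding eq by (simp add: dvd_add_left_iff)
      qed
      then have "vanishes p p (fps_of_poly (\<Sum>e\<in>exponents. P x e i * lin_mon e))"
        unfolding vanishes_def G_def by simp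
      then show ?case
        by (intro ballI lin_mon_zero_estimate[where P = "\<lambda>e. P x e i", OF degP small])
    qed
    then have "int p dvd x (e, i, l)" if "e \<in> exponents" "i < m" "l < B" for e i l
      using that unfolding of_nat_dvd_poly_iff P_def by (metis coeff_poly_of_fun)
    with x(1) show False by auto
  qed
  have s0: "s > 0" using p_eq p1 by (cases s) auto
  have mult: "\<exists>h. cong_elem (of_nat p) \<Psi> ([:-u, 1:] ^ D * h)" if u: "u \<in> residue_set" for u
  proof (rule root_multiplicity_mod[OF prime_p D])
    fix n assume n: "n < D"
    have lin: "int p dvd poly [:1, j:] u ^ s - 1" if "j \<in> J" for j
      using u that unfolding residue_set_def by (simp add: mult.commute)
    have nlin: "\<not> int p dvd poly [:1, j:] u" if "j \<in> J" for j
    proof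
      assume "int p dvd poly [:1, j:] u"
      then have "int p dvd poly [:1, j:] u ^ s" using s0 by (meson dvd_power dvd_trans)
      then have "int p dvd 1" using lin[OF that] by (metis dvd_diff_right_iff)
      then show False using p1 by simp
    qed
    \<comment> \<open>Since \<open>(1 + j u) ^ s\<close> is 1 modulo \<open>p\<close>, each
      \<open>1 + j u\<close> is invertible, and the power of \<open>lin_prod\<close> can later be
      cancelled at \<open>u\<close>.\<close>
    then have nl: "\<not> int p dvd poly (lin_prod ^ n) u"
      unfolding lin_prod_def poly_power poly_prod using prime_p
      by (intro prime_elem_not_dvd_power prime_elem_not_dvd_prod) auto
    have y1: "cong_elem (int p) (poly (lin_mon e) u) 1" for e
    proof -
      have "cong_elem (int p) (\<Prod>j\<in>J. (poly [:1, j:] u ^ s) ^ e j) (\<Prod>j\<in>J. 1 ^ e j)"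
        using lin by (intro cong_elem_prod cong_elem_power) (simp add: cong_elem_def)
      then show ?thesis by (simp add: lin_mon_def poly_prod power_mult)
    qed
    have up: "cong_elem (int p) (u ^ (p * i)) (u ^ i)" for i
    proof -
      have "cong_elem (int p) (u ^ p) u"
        using power_prime_cong_self[OF prime_p, of "nat u"] u by (simp add: residue_set_def)
      from cong_elem_power[OF this, of i] show ?thesis by (simp add: power_mult)
    qed
    have "\<Psi> = (\<Sum>e\<in>exponents. (\<Sum>i<m. monom 1 (p * i) * P x e i) * lin_mon e)"
      unfolding \<Psi>_def G_def sum_distrib_left sum_distrib_right
      by (subst sum.swap) (simp add: mult.assoc)
    then have "lin_prod ^ n * (pderiv ^^ n) \<Psi> = (\<Sum>e\<in>exponents. lin_mon e * twisted_deriv e n (\<Sum>i<m. monom 1 (p * i) * P x e i))"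
      by (simp add: funpow_pderiv_sum sum_distrib_left twisted_deriv_correct)
    also have "\<dots> = (\<Sum>e\<in>exponents. \<Sum>i<m. lin_mon e * twisted_deriv e n (monom 1 (p * i) * P x e i))"
      by (simp add: twisted_deriv_sum sum_distrib_left)
    finally have eq: "lin_prod ^ n * (pderiv ^^ n) \<Psi> = \<dots>" .
    have "cong_elem (int p) (poly (lin_mon e * twisted_deriv e n (monom 1 (p * i) * P x e i)) u)
        (poly (monom 1 i * twisted_deriv e n (P x e i)) u)" for e i
    proof -
      have "cong_elem (int p) (poly (twisted_deriv e n (monom 1 (p * i) * P x e i)) u) (poly (monom 1 (p * i) * twisted_deriv e n (P x e i)) u)"
        by (rule cong_elem_poly[OF twisted_deriv_monom])
      also have "\<dots> = u ^ (p * i) * poly (twisted_deriv e n (P x e i)) u" by (simp add: poly_monom)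
      also have "cong_elem (int p) \<dots> (u ^ i * poly (twisted_deriv e n (P x e i)) u)" by (rule cong_elem_mult[OF up cong_elem_refl])
      finally have "cong_elem (int p) (poly (lin_mon e) u * poly (twisted_deriv e n (monom 1 (p * i) * P x e i)) u)
          (1 * (u ^ i * poly (twisted_deriv e n (P x e i)) u))" by (rule cong_elem_mult[OF y1])
      then show ?thesis by (simp add: poly_monom)
    qed
    then have "cong_elem (int p) (poly (lin_prod ^ n * (pderiv ^^ n) \<Psi>) u) (poly (R x n) u)"
      unfolding eq R_def poly_sum by (intro cong_elem_sum)
    moreover have "int p dvd poly (R x n) u"
      using pR[OF n] cong_elem_poly[of p "R x n" 0 u] by (simp add: cong_elem_0_iff)
    ultimately have "int p dvd poly (lin_prod ^ n * (pderiv ^^ n) \<Psi>) u" by (simp add: cong_elem_dvd_iff)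
    then have "int p dvd poly (lin_prod ^ n) u * poly ((pderiv ^^ n) \<Psi>) u" by (simp only: poly_mult)
    then show "int p dvd poly ((pderiv ^^ n) \<Psi>) u"
      using nl prime_p by (metis prime_dvd_mult_iff prime_nat_int_transfer)
  qed
  have "D * card residue_set \<le> degree \<Psi>"
    by (rule card_roots_mod_le[OF prime_p nonzero _ _ mult]) (auto simp: residue_set_def intro: finite_subset[of _ "{0..<int p}"])
  also have "degree \<Psi> \<le> p * (m - 1) + (B - 1) + s * (q - 1) * card J"
    unfolding \<Psi>_def
  proof (rule degree_sum_le)
    fix i assume i: "i \<in> {..<m}"
    have dy: "degree (lin_mon e) \<le> s * (q - 1) * card J" if e: "e \<in> exponents" for e
    proof -
      have "degree (lin_mon e) \<le> (\<Sum>j\<in>J. degree ([:1, j:] ^ (s * e j)))"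
        unfolding lin_mon_def using degree_prod_sum_le[OF finite_J] by (simp add: o_def)
      also have "\<dots> \<le> (\<Sum>j\<in>J. s * (q - 1))"
      proof (rule sum_mono)
        fix j assume j: "j \<in> J"
        have "degree ([:1, j:] ^ (s * e j)) \<le> degree [:1, j:] * (s * e j)" by (rule degree_power_le)
        also have "\<dots> \<le> 1 * (s * (q - 1))" using exponents_less[OF e j] by (intro mult_mono) auto
        finally show "degree ([:1, j:] ^ (s * e j)) \<le> s * (q - 1)" by simp
      qed
      finally show ?thesis by (simp add: mult_ac)
    qed
    have "degree (G i) \<le> (B - 1) + s * (q - 1) * card J"
      unfolding G_def
    proof (rule degree_sum_le[OF finite_exponents])
      fix e assume "e \<in> exponents"
      from dy[OF this] degP[of e i] degree_mult_le[of "P x e i" "lin_mon e"]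
      show "degree (P x e i * lin_mon e) \<le> (B - 1) + s * (q - 1) * card J" by linarith
    qed
    moreover have "p * i \<le> p * (m - 1)" using i by (intro mult_le_mono2) auto
    ultimately show "degree (monom 1 (p * i) * G i) \<le> p * (m - 1) + (B - 1) + s * (q - 1) * card J"
      using degree_mult_le[of "monom 1 (p * i)" "G i"] degree_monom_le[of "1::int" "p * i"] by linarith
  qed simp
  finally show ?thesis .
qed

end

lemma sum_lessThan_le_square: "2 * (\<Sum>n<D. n) \<le> D * D" for D :: nat
  by (induction D) auto

text \<open>For \<open>p < 24 q\<^sup>2\<close> the trivial bound \<open>s\<close> suffices; otherwise Stepanov's method is applied with the
  least \<open>k\<close> such that \<open>q\<^sup>k \<ge> \<surd>p\<close>.\<close>

lemma card_residue_set_bound: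
  fixes p q s K D :: nat
  assumes p: "prime p" "p = q * s + 1" "q \<ge> 2" and K: "K \<ge> 3" "p \<le> 4 ^ K" "(12 * K) ^ 4 \<le> p"
    and D: "D * D \<le> p"
  shows "D * card {u \<in> {0..<int p}. \<forall>j\<in>{1..int K}. int p dvd (1 + j * u) ^ s - 1} \<le> 2 * p * K"
proof -
  let ?S = "\<lambda>K. {u \<in> {0..<int p}. \<forall>j\<in>{1..int K}. int p dvd (1 + j * u) ^ s - 1}"
  have fin: "finite (?S k)" for k by (rule finite_subset[of _ "{0..<int p}"]) auto
  \<comment> \<open>Fewer shifts give a larger set, so a bound for some \<open>k \<le> K\<close>
    suffices.\<close>
  have mono: "card (?S K) \<le> card (?S k)" if "k \<le> K" for k
    using that by (intro card_mono fin) auto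
  have p1: "p > 1" by (rule prime_gt_1_nat[OF p(1)])
  then have s0: "s > 0" using p(2) by (cases s) auto
  show ?thesis
  proof (cases "p < 24 * q * q")
    case True
    \<comment> \<open>The single shift \<open>j = 1\<close> already confines the set to roots of
      \<open>(1 + U) ^ s - 1\<close>. With \<open>D < 5 * q\<close> this yields
      \<open>5 * p\<close>, which is at most \<open>2 * p * K\<close>.\<close>
    define f where "f = [:1, 1 :: int:] ^ s - 1"
    have deg1: "degree ([:1, 1 :: int:] ^ s) = s" by (rule degree_linear_power)
    have deg: "degree f \<le> s" unfolding f_def using degree_diff_le[of "[:1, 1 :: int:] ^ s" s 1] deg1 by simp
    have "coeff f s = lead_coeff ([:1, 1 :: int:] ^ s)" using s0 by (simp add: f_def deg1)
    also have "\<dots> = 1" by (simp add: lead_coeff_power)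
    finally have nf: "\<not> of_nat p dvd f" using p1 unfolding of_nat_dvd_poly_iff by (metis int_dvd_int_iff nat_dvd_1_iff_1 of_nat_1 less_irrefl)
    have "1 * card (?S 1) \<le> degree f"
    proof (rule card_roots_mod_le[OF p(1) nf fin])
      fix u assume u: "u \<in> ?S 1"
      show "\<exists>h. cong_elem (of_nat p) f ([:-u, 1:] ^ 1 * h)"
        using u p1 by (intro root_multiplicity_mod[OF p(1)]) (auto simp: f_def add.commute)
    qed auto
    then have c: "card (?S K) \<le> s" using deg mono[of 1] K by simp
    have "D * D < (5 * q) * (5 * q)" using D True by linarith
    then have "D < 5 * q" by (metis mult_le_mono not_le)
    then have "D * card (?S K) \<le> (5 * q) * s" using c by (intro mult_le_mono) auto
    also have "\<dots> \<le> 5 * p" using p(2) by simp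
    also have "\<dots> \<le> 2 * p * K" using K(1) p1 by simp
    finally show ?thesis .
  next
    case False
    define k where "k = (LEAST k. p \<le> q ^ (2 * k))"
    have "p \<le> 4 ^ K" by (rule K)
    also have "(4::nat) ^ K = 2 ^ (2 * K)" by (simp add: power_mult)
    also have "\<dots> \<le> q ^ (2 * K)" using p(3) by (intro power_mono) auto
    finally have K': "p \<le> q ^ (2 * K)" .
    have kK: "k \<le> K" unfolding k_def using K' by (rule Least_le)
    have pk: "p \<le> q ^ (2 * k)" unfolding k_def using K' by (rule LeastI)
    have less: "q ^ (2 * i) < p" if "i < k" for i
      using not_less_Least[OF that[unfolded k_def]] by simp
    have "k \<noteq> 0" using pk p1 by (cases k) auto
    moreover have "k \<noteq> 1"
    proof
      assume "k = 1"
      then have "p \<le> q * q" using pk by (simp add: power2_eq_square)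
      moreover have "q * q > 0" using p(3) by simp
      ultimately show False using False by linarith
    qed
    ultimately have k2: "k \<ge> 2" by linarith
    define T where "T = q ^ k"
    have T0: "T > 0" using p(3) by (simp add: T_def)
    have T2: "p \<le> T * T" using pk by (simp add: T_def power_add [symmetric] mult_2)
    \<comment> \<open>For \<open>k = 2\<close> this is \<open>24 * q * q \<le> p\<close>. For larger
      \<open>k\<close>, minimality gives \<open>q ^ (2 * (k - 1)) < p\<close>, hence
      \<open>q ^ 4 \<le> p\<close> and \<open>T ^ 4 \<le> p ^ 3\<close>; the bound for
      \<open>12 * K\<close> supplies the remaining factor \<open>p\<close>.\<close>
    have kT: "12 * k * T \<le> p"
    proof (cases "k = 2")
      case True
      then show ?thesis using False by (simp add: T_def power2_eq_square mult_ac)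
    next
      case k_ne: False
      then have k3: "k - 1 \<ge> 2" using k2 by linarith
      have "q ^ 4 \<le> q ^ (2 * (k - 1))" using k3 p(3) by (intro power_increasing) auto
      also have l1: "q ^ (2 * (k - 1)) < p" using k2 by (intro less) auto
      finally have q4: "q ^ 4 \<le> p" by simp
      have "T ^ 4 = q ^ 4 * (q ^ (2 * (k - 1))) ^ 2"
        using k2 unfolding T_def power_mult [symmetric] power_add [symmetric] by (intro arg_cong[where f = "\<lambda>n. q ^ n"]) simp
      also have "\<dots> \<le> p * p ^ 2" using q4 l1 by (intro mult_le_mono power_mono) auto
      finally have "(12 * k * T) ^ 4 \<le> (12 * K) ^ 4 * (p * p ^ 2)"
        using kK unfolding power_mult_distrib[of "12 * k" T] by (intro mult_le_mono power_mono) auto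
      also have "\<dots> \<le> p * (p * p ^ 2)" using K(3) by (rule mult_le_mono1)
      also have "\<dots> = p ^ 4" by (simp add: power_numeral_reduce)
      finally have "(12 * k * T) ^ Suc 3 \<le> p ^ Suc 3" by (simp add: numeral_eq_Suc)
      then show ?thesis by (rule power_le_imp_le_base) simp
    qed
    \<comment> \<open>Just below \<open>p / T\<close>, so that \<open>T * (B + k) < p\<close> as the
      zero estimate requires, while \<open>T * B\<close> stays comparable to
      \<open>p\<close>.\<close>
    define B where "B = p div T - k - 1"
    have "12 * k \<le> p div T" using kT T0 by (simp add: less_eq_div_iff_mult_less_eq)
    then have B: "B + k + 1 = p div T" and B0: "B > 0" using k2 by (auto simp: B_def)
    have TB: "T * (B + k + 1) \<le> p" unfolding B by simp
    have TB': "p < T * (B + k + 2)"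
      using dividend_less_times_div[OF T0, of p] unfolding B[symmetric] by (simp add: algebra_simps)
    interpret power_residue_setting p q s "{1..int k}"
    proof
      have "12 * K \<le> (12 * K) ^ 4" using K(1) by (intro self_le_power) auto
      then have "k < p" using kK K(1,3) by linarith
      then show "{1..int k} \<subseteq> {1..<int p}" by auto
    qed (use p in auto)
    have "D * D \<le> T * T" using D T2 by linarith
    then have DT: "D \<le> T" by (metis power2_nat_le_eq_le power2_eq_square)
    have "D \<le> D * D" by (cases D) auto
    then have Dp: "D \<le> p" using D by linarith
    have Tk: "T * (B + k) < p" using TB T0 by simp
    \<comment> \<open>The parameter \<open>m\<close> is taken to be \<open>k\<close>. By
      \<open>D \<le> T\<close> and \<open>D * D \<le> p\<close>, twice the number of conditions is
      below \<open>(k + 1) * p\<close>; by \<open>kT\<close>, twice the number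
      \<open>T * k * B\<close> of unknowns is at least that.\<close>
    have count: "(\<Sum>n<D. B + k + n * (k - 1)) < T * k * B"
    proof -
      have eq: "(\<Sum>n<D. B + k + n * (k - 1)) = D * (B + k) + (\<Sum>n<D. n) * (k - 1)"
        by (simp add: sum.distrib sum_distrib_right)
      have "2 * (\<Sum>n<D. B + k + n * (k - 1)) = 2 * (D * (B + k)) + (2 * (\<Sum>n<D. n)) * (k - 1)"
        unfolding eq by simp
      also have "\<dots> \<le> 2 * (T * (B + k)) + p * (k - 1)"
        using DT sum_lessThan_le_square[of D] D by (intro add_mono mult_le_mono) auto
      also have "\<dots> < 2 * p + p * (k - 1)" using TB T0 by simp
      also have "\<dots> = (k + 1) * p" using k2 by (cases k) (auto simp: algebra_simps)
      finally have 1: "2 * (\<Sum>n<D. B + k + n * (k - 1)) < (k + 1) * p" .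
      have "(k + 1) * p \<le> 2 * (T * k * B)"
      proof -
        have "6 * (2 * (T * k * B)) + (12 * k * T) * (k + 2) = 12 * k * (T * (B + k + 2))" by (simp add: algebra_simps)
        moreover have "12 * k * (T * (B + k + 2)) \<ge> 12 * k * p" using TB' by (intro mult_le_mono) auto
        moreover have "(12 * k * T) * (k + 2) \<le> p * (k + 2)" using kT by (rule mult_le_mono1)
        ultimately have "12 * k * p \<le> 6 * (2 * (T * k * B)) + p * (k + 2)" by linarith
        moreover have "2 * p \<le> k * p" using k2 by (rule mult_le_mono1)
        moreover have "12 * k * p = 12 * (k * p)" "p * (k + 2) = k * p + 2 * p" "(k + 1) * p = k * p + p"
          by (simp_all add: algebra_simps)
        ultimately show ?thesis by linarith
      qed
      with 1 show ?thesis by linarith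
    qed
    have "D * card residue_set \<le> p * (k - 1) + (B - 1) + s * (q - 1) * card {1..int k}"
      using Tk k2 B0 Dp count by (intro card_residue_set_le) (auto simp: T_def)
    also have "\<dots> \<le> p * (k - 1) + p + p * k"
    proof -
      have "B \<le> T * (B + k + 1)" using T0 by (cases T) auto
      then have "B - 1 \<le> p" using TB by linarith
      moreover have "s * (q - 1) \<le> p" using p(2) by (simp add: diff_mult_distrib2 mult.commute)
      then have "s * (q - 1) * card {1..int k} \<le> p * k" by simp
      ultimately show ?thesis by linarith
    qed
    also have "\<dots> = 2 * p * k" using k2 by (cases k) (auto simp: algebra_simps)
    also have "\<dots> \<le> 2 * p * K" using kK by simp
    finally have "D * card residue_set \<le> 2 * p * K" .
    moreover have "residue_set = ?S k" unfolding residue_set_def ..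
    ultimately show ?thesis using mono[OF kK] by (metis (no_types, lifting) le_trans mult_le_mono2)
  qed
qed

section \<open>Characters and runs of equal values\<close>

lemma dirichlet_character_cong:
  assumes "dirichlet_character p \<chi>" "int p dvd a - b"
  shows "\<chi> a = \<chi> b"
proof -
  have per: "\<chi> (n + int p) = \<chi> n" for n using assms(1) by (simp add: dirichlet_character_def)
  have nat: "\<chi> (n + int p * int k) = \<chi> n" for n k
  proof (induction k)
    case (Suc k)
    have "n + int p * int (Suc k) = (n + int p * int k) + int p" by (simp add: algebra_simps)
    with Suc per show ?case by metis
  qed simp
  obtain c where c: "a - b = int p * c" using assms(2) by blast
  show ?thesis
  proof (cases "c \<ge> 0")
    case True
    then show ?thesis using nat[of b "nat c"] c by (simp add: algebra_simps)
  next
    case False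
    then show ?thesis using nat[of a "nat (- c)"] c by (simp add: algebra_simps)
  qed
qed

lemma dirichlet_character_1: "dirichlet_character p \<chi> \<Longrightarrow> \<chi> 1 = 1"
  unfolding dirichlet_character_def by (metis coprime_1_left mult_cancel_left1 mult_1)

lemma dirichlet_character_power: "dirichlet_character p \<chi> \<Longrightarrow> \<chi> (a ^ n) = \<chi> a ^ n"
  by (induction n) (simp_all add: dirichlet_character_1, simp add: dirichlet_character_def)

text \<open>\<open>q\<close> is the order of \<open>\<chi> g\<close> for a primitive root
  \<open>g\<close>, and exceeds 1 because \<open>\<chi>\<close> is non-principal. If
  \<open>\<chi> (g ^ i) = 1\<close>, then \<open>q\<close> divides \<open>i\<close>, so
  \<open>(g ^ i) ^ s\<close> is a power of \<open>g ^ (p - 1)\<close>.\<close>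

lemma nonprincipal_character_kernel:
  assumes p: "prime p" and \<chi>: "dirichlet_character p \<chi>" "\<chi> \<noteq> principal_character p"
  obtains q s where "p = q * s + 1" "q \<ge> 2" "\<And>a. \<chi> a = 1 \<Longrightarrow> int p dvd a ^ s - 1"
proof -
  have p1: "p > 1" by (rule prime_gt_1_nat[OF p])
  obtain g where g: "residue_primroot p g" using prime_primitive_root_exists[OF p1 p] by blast
  have cg: "coprime (int g) (int p)"
    using g by (simp add: residue_primroot_def coprime_commute)
  have mult: "\<chi> (a * b) = \<chi> a * \<chi> b" for a b using \<chi>(1) by (simp add: dirichlet_character_def)
  have nz: "\<chi> n \<noteq> 0 \<longleftrightarrow> coprime n (int p)" for n using \<chi>(1) by (simp add: dirichlet_character_def)
  have gen: "\<exists>i. int p dvd a - int g ^ i" if "coprime a (int p)" for a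
  proof -
    have "coprime (a mod int p) (int p)" using that p1 by simp
    moreover have "a mod int p = int (nat (a mod int p))" using p1 by simp
    ultimately have "coprime (nat (a mod int p)) p" by (metis coprime_int_iff)
    moreover have "nat (a mod int p) < p" using p1 by (simp add: nat_less_iff)
    moreover have "nat (a mod int p) \<noteq> 0"
      using \<open>coprime (nat (a mod int p)) p\<close> p1 by (metis coprime_0_left_iff nat_dvd_1_iff_1 less_irrefl)
    ultimately have "nat (a mod int p) \<in> totatives p"
      by (auto simp: totatives_def)
    then obtain i where "nat (a mod int p) = g ^ i mod p"
      using residue_primroot_is_generator[OF p1 g] unfolding bij_betw_def by auto
    then have "a mod int p = int g ^ i mod int p"
      by (metis \<open>a mod int p = int (nat (a mod int p))\<close> of_nat_mod of_nat_power)
    then show ?thesis by (auto simp: mod_eq_dvd_iff)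
  qed
  define \<zeta> where "\<zeta> = \<chi> (int g)"
  have pow: "\<chi> (int g ^ i) = \<zeta> ^ i" for i unfolding \<zeta>_def by (rule dirichlet_character_power[OF \<chi>(1)])
  have "\<zeta> \<noteq> 1"
  proof
    assume "\<zeta> = 1"
    have "\<chi> n = principal_character p n" for n
    proof (cases "coprime n (int p)")
      case True
      then obtain i where "int p dvd n - int g ^ i" using gen by blast
      then have "\<chi> n = \<zeta> ^ i" using dirichlet_character_cong[OF \<chi>(1)] pow by metis
      then show ?thesis using True \<open>\<zeta> = 1\<close> by (simp add: principal_character_def)
    next
      case False
      then show ?thesis using nz[of n] by (simp add: principal_character_def)
    qed
    then show False using \<chi>(2) by blast
  qed
  have "\<not> p dvd g" using cg p1 by (metis coprime_commute coprime_int_iff coprime_absorb_left not_prime_unit p)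
  then have fermat: "int p dvd int g ^ (p - 1) - 1"
    using fermat_theorem[OF p] by (simp add: cong_iff_dvd_diff flip: cong_int_iff)
  have "\<zeta> ^ (p - 1) = 1"
    using dirichlet_character_cong[OF \<chi>(1) fermat] pow dirichlet_character_1[OF \<chi>(1)] by simp
  then have ex: "0 < p - 1 \<and> \<zeta> ^ (p - 1) = 1" using p1 by simp
  define q where "q = (LEAST q. 0 < q \<and> \<zeta> ^ q = 1)"
  have q: "0 < q" "\<zeta> ^ q = 1" unfolding q_def using LeastI[of "\<lambda>q. 0 < q \<and> \<zeta> ^ q = 1", OF ex] by auto
  have dvd: "q dvd i" if "\<zeta> ^ i = 1" for i
  proof (rule ccontr)
    assume "\<not> q dvd i"
    then have "0 < i mod q" by (simp add: dvd_eq_mod_eq_0)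
    moreover have "\<zeta> ^ i = (\<zeta> ^ q) ^ (i div q) * \<zeta> ^ (i mod q)"
      by (simp flip: power_mult power_add)
    then have "\<zeta> ^ (i mod q) = 1" using q that by simp
    ultimately have "q \<le> i mod q" unfolding q_def by (intro Least_le) simp
    then show False using q(1) by (metis mod_less_divisor not_le)
  qed
  obtain s where s: "p - 1 = q * s" using dvd ex by blast
  show thesis
  proof
    show "p = q * s + 1" using s p1 by simp
    have "q \<noteq> 1" using q(2) \<open>\<zeta> \<noteq> 1\<close> by auto
    then show "q \<ge> 2" using q(1) by linarith
    fix a assume a: "\<chi> a = 1"
    then have "coprime a (int p)" using nz[of a] by simp
    then obtain i where i: "int p dvd a - int g ^ i" using gen by blast
    then have "\<zeta> ^ i = 1" using a dirichlet_character_cong[OF \<chi>(1)] pow by metis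
    then obtain t where t: "i = q * t" using dvd by blast
    have "cong_elem (int p) (a ^ s) ((int g ^ i) ^ s)" using i by (intro cong_elem_power) (simp add: cong_elem_def)
    also have "(int g ^ i) ^ s = (int g ^ (p - 1)) ^ t"
      unfolding s t by (simp add: mult_ac flip: power_mult)
    also have "cong_elem (int p) \<dots> (1 ^ t)" using fermat by (intro cong_elem_power) (simp add: cong_elem_def)
    finally show "int p dvd a ^ s - 1" by (simp add: cong_elem_def)
  qed
qed

text \<open>A run of \<open>h\<close> values counts \<open>z\<close> itself, so \<open>Suc K\<close>
  values provide the shifts \<open>1, ..., K\<close>. A nonzero value makes \<open>z\<close>
  invertible modulo \<open>p\<close>.\<close>

definition const_run :: "(int \<Rightarrow> complex) \<Rightarrow> nat \<Rightarrow> int \<Rightarrow> bool" where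
  "const_run \<chi> h z \<longleftrightarrow> \<chi> z \<noteq> 0 \<and> (\<forall>i\<in>{0..<int h}. \<chi> (z + i) = \<chi> z)"

text \<open>The substitution \<open>z = 1 / u\<close> turns \<open>\<chi> (z + j) = \<chi> z\<close> into \<open>\<chi> (1 + j u) = 1\<close>.\<close>

lemma card_const_run_le:
  assumes p: "prime p" and \<chi>: "dirichlet_character p \<chi>" and ker: "\<And>a. \<chi> a = 1 \<Longrightarrow> int p dvd a ^ s - 1"
  shows "card {z\<in>{0..<int p}. const_run \<chi> (Suc K) z}
    \<le> card {u \<in> {0..<int p}. \<forall>j\<in>{1..int K}. int p dvd (1 + j * u) ^ s - 1}"
proof -
  have p1: "p > 1" by (rule prime_gt_1_nat[OF p])
  have mult: "\<chi> (a * b) = \<chi> a * \<chi> b" for a b using \<chi> by (simp add: dirichlet_character_def)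
  have ex: "\<exists>u\<in>{0..<int p}. int p dvd z * u - 1" if "\<chi> z \<noteq> 0" for z
  proof -
    have "coprime z (int p)" using that \<chi> by (simp add: dirichlet_character_def)
    then obtain u where "[z * u = 1] (mod int p)" by (metis cong_solve_coprime_int)
    then have "[z * (u mod int p) = 1] (mod int p)" by (metis cong_def mod_mult_right_eq)
    then have "int p dvd z * (u mod int p) - 1" by (simp add: cong_iff_dvd_diff)
    moreover have "u mod int p \<in> {0..<int p}" using p1 by simp
    ultimately show ?thesis by blast
  qed
  define zinv where "zinv z = (SOME u. u \<in> {0..<int p} \<and> int p dvd z * u - 1)" for z
  have zinv: "zinv z \<in> {0..<int p} \<and> int p dvd z * zinv z - 1" if "\<chi> z \<noteq> 0" for z
  proof -
    have "\<exists>u. u \<in> {0..<int p} \<and> int p dvd z * u - 1" using ex[OF that] by blast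
    then show ?thesis unfolding zinv_def by (rule someI_ex)
  qed
  show ?thesis
  proof (rule card_inj_on_le)
    show "inj_on zinv {z\<in>{0..<int p}. const_run \<chi> (Suc K) z}"
    proof (rule inj_onI)
      fix z z' assume z: "z \<in> {z\<in>{0..<int p}. const_run \<chi> (Suc K) z}" "z' \<in> {z\<in>{0..<int p}. const_run \<chi> (Suc K) z}"
        and eq: "zinv z = zinv z'"
      have "int p dvd z * zinv z - 1" "int p dvd z' * zinv z - 1"
        using z zinv[of z] zinv[of z'] eq by (auto simp: const_run_def)
      \<comment> \<open>With \<open>u\<close> the common inverse,
        \<open>z' (z u - 1) - z (z' u - 1) = z - z'\<close>.\<close>
      from dvd_diff[OF dvd_mult[OF this(1), of z'] dvd_mult[OF this(2), of z]]
      have "int p dvd z - z'" by (simp add: algebra_simps)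
      then show "z = z'" using z by (metis (no_types, lifting) atLeastLessThan_iff mem_Collect_eq mod_eq_dvd_iff mod_pos_pos_trivial)
    qed
    show "zinv ` {z\<in>{0..<int p}. const_run \<chi> (Suc K) z} \<subseteq> {u \<in> {0..<int p}. \<forall>j\<in>{1..int K}. int p dvd (1 + j * u) ^ s - 1}"
    proof (intro subsetI, elim imageE)
      fix u z assume u: "u = zinv z" and z: "z \<in> {z\<in>{0..<int p}. const_run \<chi> (Suc K) z}"
      then have run: "\<chi> z \<noteq> 0" "\<And>i. i \<in> {0..<int (Suc K)} \<Longrightarrow> \<chi> (z + i) = \<chi> z" by (auto simp: const_run_def)
      note zinv = zinv[OF run(1), folded u, THEN conjunct1] zinv[OF run(1), folded u, THEN conjunct2]
      have "int p dvd (1 + j * u) ^ s - 1" if j: "j \<in> {1..int K}" for j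
      proof (rule ker)
        have "z * (1 + j * u) - (z + j) = j * (z * u - 1)" by (simp add: algebra_simps)
        then have "\<chi> (z * (1 + j * u)) = \<chi> (z + j)"
          using zinv(2) by (intro dirichlet_character_cong[OF \<chi>]) simp
        also have "\<chi> (z + j) = \<chi> z" using j by (intro run) auto
        finally show "\<chi> (1 + j * u) = 1" using run(1) mult by simp
      qed
      then show "u \<in> {u \<in> {0..<int p}. \<forall>j\<in>{1..int K}. int p dvd (1 + j * u) ^ s - 1}" using zinv(1) by auto
    qed
  qed (rule finite_subset[of _ "{0..<int p}"], auto)
qed

section \<open>Counting pairs \<open>(q, t)\<close> for which \<open>(a t + b) / q\<close> is in
  lowest terms\<close>

definition good_pairs :: "int \<Rightarrow> int \<Rightarrow> nat \<Rightarrow> (int \<times> int) set" where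
  "good_pairs a b X = {(q, t). q \<in> {1..int X} \<and> t \<in> {0..<q} \<and> coprime (a * t + b) q}"

definition triangle :: "nat \<Rightarrow> (int \<times> int) set" where
  "triangle X = (SIGMA q:{1..int X}. {0..<q})"

lemma finite_triangle: "finite (triangle X)"
  unfolding triangle_def by simp

lemma card_triangle: "2 * card (triangle X) = X * (X + 1)"
proof -
  have "card (triangle X) = (\<Sum>q\<in>{1..int X}. nat q)" unfolding triangle_def by simp
  also have "\<dots> = (\<Sum>q\<in>{1..X}. q)"
    by (rule sum.reindex_bij_witness[of _ int nat]) auto
  also have "2 * \<dots> = X * (X + 1)" by (induction X) auto
  finally show ?thesis .
qed

text \<open>A divisor \<open>d\<close> of \<open>a t + b\<close> is prime to \<open>a\<close>, so it
  fixes \<open>t\<close> modulo \<open>d\<close>. The pair is then recovered from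
  \<open>q div d\<close> and \<open>t div d\<close>.\<close>

lemma card_common_divisor_pairs:
  assumes "coprime a b" "d \<ge> 2"
  shows "card {(q, t) \<in> triangle X. int d dvd q \<and> int d dvd a * t + b} \<le> card (triangle (X div d))"
proof (rule card_inj_on_le)
  let ?f = "\<lambda>(q, t). (q div int d, t div int d)"
  let ?S = "{(q, t) \<in> triangle X. int d dvd q \<and> int d dvd a * t + b}"
  show "inj_on ?f ?S"
  proof (rule inj_onI)
    fix x x'
    assume x: "x \<in> ?S" "x' \<in> ?S" and eqx: "?f x = ?f x'"
    obtain q t q' t' where x_eq: "x = (q, t)" "x' = (q', t')" by (cases x, cases x')
    have qt: "(q, t) \<in> triangle X" "int d dvd q" "int d dvd a * t + b"
      and qt': "(q', t') \<in> triangle X" "int d dvd q'" "int d dvd a * t' + b"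
      using x by (auto simp: x_eq)
    have eq: "?f (q, t) = ?f (q', t')" using eqx by (simp only: x_eq)
    have "q = q'" using eq qt(2) qt'(2) by (metis case_prod_conv dvd_mult_div_cancel prod.inject)
    have "coprime a (int d)"
    proof (rule coprimeI)
      fix c assume c: "c dvd a" "c dvd int d"
      then have "c dvd a * t + b" using qt(3) dvd_trans by blast
      then have "c dvd b" using c(1) by (metis dvd_add_right_iff dvd_mult2)
      then show "is_unit c" using c(1) assms(1) coprime_common_divisor by blast
    qed
    moreover have "int d dvd a * (t - t')"
      using dvd_diff[OF qt(3) qt'(3)] by (simp add: algebra_simps)
    ultimately have "int d dvd t - t'" by (metis coprime_commute coprime_dvd_mult_right_iff)
    then have "t mod int d = t' mod int d" by (simp add: mod_eq_dvd_iff)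
    moreover have "t div int d = t' div int d" using eq by simp
    ultimately have "t = t'" by (metis div_mult_mod_eq)
    with \<open>q = q'\<close> show "x = x'" by (simp add: x_eq)
  qed
  show "?f ` ?S \<subseteq> triangle (X div d)"
  proof
    fix y assume "y \<in> ?f ` ?S"
    then obtain q t where y: "y = (q div int d, t div int d)" and tri: "(q, t) \<in> triangle X"
      and d: "int d dvd q" by auto
    from tri have q: "1 \<le> q" "q \<le> int X" "0 \<le> t" "t < q" by (auto simp: triangle_def)
    have "int d > 0" using assms(2) by simp
    obtain k where k: "q = int d * k" using d by blast
    then have "k \<ge> 1" using q(1) \<open>int d > 0\<close> by (metis int_one_le_iff_zero_less zero_less_mult_pos less_le_trans zero_less_one)
    moreover have "q div int d \<le> int X div int d" using q(2) \<open>int d > 0\<close> by (intro zdiv_mono1)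
    moreover have "t < k * int d" using q(4) k by (simp add: mult.commute)
    then have "t div int d * int d < k * int d"
      using div_mult_mod_eq[of t "int d"] pos_mod_sign[OF \<open>int d > 0\<close>, of t] by linarith
    then have "t div int d < k" by (rule mult_right_less_imp_less) simp
    ultimately show "y \<in> triangle (X div d)"
      using k \<open>int d > 0\<close> q(3) by (simp add: y triangle_def zdiv_int pos_imp_zdiv_nonneg_iff)
  qed
qed (rule finite_triangle)

text \<open>Telescoping, from \<open>1 / d^2 \<le> 1 / (d - 1/2) - 1 / (d + 1/2)\<close>; the sum
  starts with \<open>1 / (3/2)\<close>.\<close>

lemma sum_inverse_squares_le: "(\<Sum>d=2..X. 1 / real d ^ 2) \<le> 2 / 3"
proof -
  have "(\<Sum>d=2..X. 1 / real d ^ 2) \<le> 2 / 3 - 1 / (real X + 1 / 2)" if "X \<ge> 1"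
    using that
  proof (induction X rule: nat_induct_at_least)
    case (Suc X)
    have "(\<Sum>d=2..Suc X. 1 / real d ^ 2) = (\<Sum>d=2..X. 1 / real d ^ 2) + 1 / real (Suc X) ^ 2"
      using Suc.hyps by (simp add: sum.cl_ivl_Suc)
    moreover have "1 / real (Suc X) ^ 2 \<le> 1 / (real X + 1 / 2) - 1 / (real (Suc X) + 1 / 2)"
    proof -
      have "1 / (real X + 1 / 2) - 1 / (real (Suc X) + 1 / 2) = 1 / ((real X + 1 / 2) * (real X + 3 / 2))"
        by (simp add: field_simps)
      also have "\<dots> \<ge> 1 / real (Suc X) ^ 2"
        using Suc.hyps by (intro divide_left_mono) (auto simp: power2_eq_square algebra_simps intro!: mult_pos_pos add_nonneg_pos)
      finally show ?thesis .
    qed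
    ultimately show ?case using Suc.IH by linarith
  qed simp
  moreover have "1 / (real X + 1 / 2) \<ge> 0" by simp
  ultimately show ?thesis by (cases "X \<ge> 1") (linarith, simp)
qed

text \<open>Of about \<open>X^2 / 2\<close> pairs, at most about \<open>X^2 / (2 d^2)\<close> share
  a divisor \<open>d \<ge> 2\<close>, so about \<open>X^2 / 6\<close> remain by
  \<open>sum_inverse_squares_le\<close>. The constant \<open>4/25\<close> leaves room for lower
  order terms.\<close>

lemma card_good_pairs_ge:
  assumes "coprime a b" "X \<ge> 10000"
  shows "real (card (good_pairs a b X)) \<ge> 4 / 25 * real X ^ 2"
proof -
  let ?bad = "\<lambda>d. {(q, t) \<in> triangle X. int d dvd q \<and> int d dvd a * t + b}"
  have "triangle X \<subseteq> good_pairs a b X \<union> (\<Union>d\<in>{2..X}. ?bad d)"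
  proof
    fix x assume x: "x \<in> triangle X"
    obtain q t where qt: "x = (q, t)" by (cases x)
    have q: "1 \<le> q" "q \<le> int X" "t \<in> {0..<q}" using x qt by (auto simp: triangle_def)
    show "x \<in> good_pairs a b X \<union> (\<Union>d\<in>{2..X}. ?bad d)"
    proof (cases "coprime (a * t + b) q")
      case True
      then show ?thesis using q qt by (simp add: good_pairs_def)
    next
      case False
      define d where "d = nat (gcd (a * t + b) q)"
      have d: "int d = gcd (a * t + b) q" by (simp add: d_def)
      have "int d dvd q" "int d dvd a * t + b" unfolding d by auto
      moreover have "int d \<noteq> 1" using False d by (simp add: coprime_iff_gcd_eq_1)
      moreover have "int d \<noteq> 0" using q d by auto
      moreover have "int d \<le> q" using q \<open>int d dvd q\<close> by (intro zdvd_imp_le) auto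
      ultimately show ?thesis using x q qt by (intro UnI2 UN_I[of d]) auto
    qed
  qed
  moreover have "finite (good_pairs a b X)"
    by (rule finite_subset[OF _ finite_triangle[of X]]) (auto simp: good_pairs_def triangle_def)
  moreover have fin: "finite (?bad d)" for d by (rule finite_subset[OF _ finite_triangle[of X]]) auto
  ultimately have "card (triangle X) \<le> card (good_pairs a b X \<union> (\<Union>d\<in>{2..X}. ?bad d))"
    by (intro card_mono) auto
  also have "\<dots> \<le> card (good_pairs a b X) + card (\<Union>d\<in>{2..X}. ?bad d)" by (rule card_Un_le)
  also have "card (\<Union>d\<in>{2..X}. ?bad d) \<le> (\<Sum>d\<in>{2..X}. card (?bad d))" by (rule card_UN_le) simp
  also have "\<dots> \<le> (\<Sum>d\<in>{2..X}. card (triangle (X div d)))"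
    by (intro sum_mono card_common_divisor_pairs assms(1)) simp
  finally have "2 * card (triangle X) \<le> 2 * card (good_pairs a b X) + (\<Sum>d\<in>{2..X}. 2 * card (triangle (X div d)))"
    by (simp flip: sum_distrib_left)
  then have "X * (X + 1) \<le> 2 * card (good_pairs a b X) + (\<Sum>d\<in>{2..X}. (X div d) * (X div d + 1))"
    unfolding card_triangle .
  then have "real (X * (X + 1)) \<le> real (2 * card (good_pairs a b X) + (\<Sum>d\<in>{2..X}. (X div d) * (X div d + 1)))"
    by (simp only: of_nat_le_iff)
  then have 1: "real X ^ 2 + real X \<le> 2 * real (card (good_pairs a b X)) + (\<Sum>d\<in>{2..X}. real (X div d) * (real (X div d) + 1))"
    by (simp add: power2_eq_square algebra_simps)
  have "(\<Sum>d\<in>{2..X}. real (X div d) * (real (X div d) + 1)) \<le>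
      (\<Sum>d\<in>{2..X}. (real X ^ 2 + 50 * real X) * (1 / real d ^ 2) + real X / 200)"
  proof (rule sum_mono)
    fix d assume d: "d \<in> {2..X}"
    have le: "real (X div d) \<le> real X / real d" by (rule of_nat_div_le_of_nat)
    have "real (X div d) * (real (X div d) + 1) \<le> real X / real d * (real X / real d + 1)"
      using le by (intro mult_mono) auto
    also have "\<dots> = real X ^ 2 * (1 / real d ^ 2) + real X * (1 / real d)"
      using d by (simp add: field_simps power2_eq_square)
    \<comment> \<open>Expanding \<open>(1/d - 1/100)^2 \<ge> 0\<close> replaces the harmonic sum by
      the sum of inverse squares and a small constant per term.\<close>
    also have "real X * (1 / real d) \<le> real X * (50 * (1 / real d ^ 2) + 1 / 200)"
    proof (rule mult_left_mono)
      have "(1 / real d - 1 / 100)\<^sup>2 \<ge> 0" by simp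
      then show "1 / real d \<le> 50 * (1 / real d ^ 2) + 1 / 200"
        by (simp add: power2_diff power_divide)
    qed simp
    finally show "real (X div d) * (real (X div d) + 1) \<le> (real X ^ 2 + 50 * real X) * (1 / real d ^ 2) + real X / 200"
      by (simp add: algebra_simps)
  qed
  also have "\<dots> = (real X ^ 2 + 50 * real X) * (\<Sum>d\<in>{2..X}. 1 / real d ^ 2) + real (card {2..X}) * (real X / 200)"
    by (simp add: sum.distrib sum_distrib_left)
  also have "\<dots> \<le> (real X ^ 2 + 50 * real X) * (2 / 3) + real X * (real X / 200)"
    by (intro add_mono mult_left_mono mult_right_mono sum_inverse_squares_le) auto
  finally have "real X ^ 2 + real X \<le> 2 * real (card (good_pairs a b X)) + ((real X ^ 2 + 50 * real X) * (2 / 3) + real X * (real X / 200))"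
    using 1 by linarith
  moreover have "10000 * real X \<le> real X ^ 2"
    using assms(2) by (simp add: power2_eq_square mult_right_mono)
  moreover have "real X * (real X / 200) = real X ^ 2 / 200" by (simp add: power2_eq_square)
  moreover have "(real X ^ 2 + 50 * real X) * (2 / 3) = 2 / 3 * real X ^ 2 + 100 / 3 * real X"
    by (simp add: field_simps)
  ultimately show ?thesis by linarith
qed

text \<open>The runs come from the intervals \<open>{z. N < q z - p t \<le> N + H}\<close>, on which \<open>\<chi>\<close> is constant.
  Approximating \<open>N / p\<close> by a fraction \<open>b / a\<close> shows that those with \<open>coprime (a t + b) q\<close> are disjoint
  modulo \<open>p\<close>.\<close>

lemma card_const_run_ge:
  fixes p h X :: nat and N :: int
  assumes p: "prime p" and \<chi>: "dirichlet_character p \<chi>"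
    and const: "\<And>n. N < n \<Longrightarrow> n \<le> N + int (2 * h * X) \<Longrightarrow> \<chi> n = c"
    and h: "h > 0" and X: "X > 0" and small: "8 * h * X ^ 3 \<le> p"
  obtains a b where "coprime a b"
    "h * card (good_pairs a b X) \<le> card {z\<in>{0..<int p}. const_run \<chi> h z}"
proof -
  define H where "H = int (2 * h * X)"
  have p0: "int p > 0" using prime_gt_0_nat[OF p] by simp
  have mult: "\<chi> (m * n) = \<chi> m * \<chi> n" for m n using \<chi> by (simp add: dirichlet_character_def)
  have nz: "\<chi> n \<noteq> 0 \<longleftrightarrow> coprime n (int p)" for n using \<chi> by (simp add: dirichlet_character_def)
  have H2: "H \<ge> 2" using h X unfolding H_def by (cases h; cases X) auto
  \<comment> \<open>Otherwise both \<open>N + 1\<close> and \<open>N + 2\<close> would be multiples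
    of \<open>p\<close>.\<close>
  have c: "c \<noteq> 0"
  proof
    assume "c = 0"
    then have "\<chi> (N + 1) = 0" "\<chi> (N + 2) = 0" using const[of "N + 1"] const[of "N + 2"] H2 by (auto simp: H_def)
    then have "\<not> coprime (N + 1) (int p)" "\<not> coprime (N + 2) (int p)" using nz by blast+
    then have "int p dvd N + 1" "int p dvd N + 2"
      using p by (metis coprime_commute prime_imp_coprime prime_nat_int_transfer)+
    then have "int p dvd (N + 2) - (N + 1)" by (rule dvd_diff[rotated])
    then show False using prime_gt_1_nat[OF p] by simp
  qed
  \<comment> \<open>Denominators up to \<open>2 * X\<close> make \<open>\<rho> = a N - b p\<close>
    smaller than \<open>p / (2 X)\<close> in absolute value.\<close>
  obtain b a where ab: "coprime b a" "0 < a" "a \<le> int (2 * X)"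
    "\<bar>of_int a * (real_of_int N / real p) - of_int b\<bar> < 1 / real (2 * X)"
    using Dirichlet_approx_coprime[of "2 * X" "real_of_int N / real p"] X by auto
  define \<rho> where "\<rho> = a * N - b * int p"
  have "\<bar>real_of_int \<rho>\<bar> = \<bar>of_int a * (real_of_int N / real p) - of_int b\<bar> * real p"
  proof -
    have "real_of_int \<rho> = (of_int a * (real_of_int N / real p) - of_int b) * real p"
      unfolding \<rho>_def using p0 by (simp add: field_simps)
    then show ?thesis by (simp add: abs_mult)
  qed
  also have "\<dots> < 1 / real (2 * X) * real p" using ab(4) p0 by (intro mult_strict_right_mono) auto
  finally have "\<bar>real_of_int \<rho>\<bar> * real (2 * X) < real p" using X by (simp add: field_simps)
  then have "real_of_int (2 * int X * \<bar>\<rho>\<bar>) < real_of_int (int p)" by (simp add: mult_ac)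
  then have rho: "2 * int X * \<bar>\<rho>\<bar> < int p" by (simp only: of_int_less_iff)
  \<comment> \<open>The least integer \<open>z\<close> with \<open>q z > N + p t\<close>.\<close>
  define z0 where "z0 = (\<lambda>(q, t). (N + int p * t) div q + 1)"
  have z0: "N + int p * t < q * z0 (q, t)" "q * z0 (q, t) \<le> N + int p * t + q" if "q > 0" for q t
  proof -
    define y where "y = N + int p * t"
    have "q * z0 (q, t) = q * (y div q) + q" unfolding z0_def y_def by (simp add: algebra_simps)
    moreover have "q * (y div q) + y mod q = y" by simp
    moreover have "0 \<le> y mod q" "y mod q < q" using that by auto
    ultimately show "N + int p * t < q * z0 (q, t)" "q * z0 (q, t) \<le> N + int p * t + q"
      unfolding y_def[symmetric] by linarith+
  qed
  \<comment> \<open>A window of length \<open>H = 2 h X\<close>, divided by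
    \<open>q \<le> X\<close>, contains \<open>2 h\<close> consecutive integers; so each of the first
    \<open>h\<close> of them starts a run of length \<open>h\<close>.\<close>
  have range: "N + int p * t < q * (z0 (q, t) + i)" "q * (z0 (q, t) + i) \<le> N + int p * t + H"
    if "q \<in> {1..int X}" "0 \<le> i" "i < 2 * int h" for q t i
  proof -
    have q: "q > 0" "q \<le> int X" using that by auto
    have "q * i \<ge> 0" using q that by simp
    moreover have "q * (1 + i) \<le> int X * (2 * int h)" using q that by (intro mult_mono) auto
    then have "q + q * i \<le> H" unfolding H_def by (simp add: algebra_simps)
    ultimately show "N + int p * t < q * (z0 (q, t) + i)" "q * (z0 (q, t) + i) \<le> N + int p * t + H"
      using z0[OF q(1), of t] by (auto simp: distrib_left)
  qed
  have val: "\<chi> q * \<chi> (z0 (q, t) + i) = c" if "q \<in> {1..int X}" "0 \<le> i" "i < 2 * int h" for q t i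
  proof -
    let ?z = "z0 (q, t) + i"
    have "\<chi> (q * ?z - int p * t) = c" using range[OF that, of t] by (intro const) (auto simp: H_def)
    moreover have "\<chi> (q * ?z - int p * t) = \<chi> (q * ?z)" by (intro dirichlet_character_cong[OF \<chi>]) simp
    ultimately show ?thesis using mult by simp
  qed
  have run: "const_run \<chi> h ((z0 (q, t) + i) mod int p)" if q: "q \<in> {1..int X}" and i: "i \<in> {0..<int h}" for q t i
  proof -
    let ?z = "z0 (q, t) + i"
    have per: "\<chi> (?z mod int p + j) = \<chi> (?z + j)" for j
    proof (intro dirichlet_character_cong[OF \<chi>])
      have "?z mod int p + j - (?z + j) = - (int p * (?z div int p))"
        by (simp add: algebra_simps minus_div_mult_eq_mod [symmetric])
      then show "int p dvd ?z mod int p + j - (?z + j)" by simp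
    qed
    have v: "\<chi> q * \<chi> (?z + j) = c" if "j \<in> {0..<int h}" for j
      using val[OF q, of "i + j" t] i that by (simp add: add.assoc)
    then have q0: "\<chi> q \<noteq> 0" and z: "\<chi> ?z \<noteq> 0" using c v[of 0] h by auto
    have "\<chi> (?z + j) = \<chi> ?z" if "j \<in> {0..<int h}" for j
      using v[OF that] v[of 0] q0 h by (metis add_0_right atLeastLessThan_iff mult_cancel_left of_nat_0_less_iff order_refl)
    then show ?thesis unfolding const_run_def using z per per[of 0] by simp
  qed
  define \<phi> where "\<phi> = (\<lambda>(qt, i). (z0 qt + i) mod int p)"
  have "inj_on \<phi> (good_pairs a b X \<times> {0..<int h})"
  proof (rule inj_onI)
    fix x x'
    assume x: "x \<in> good_pairs a b X \<times> {0..<int h}" "x' \<in> good_pairs a b X \<times> {0..<int h}" and eqx: "\<phi> x = \<phi> x'"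
    obtain q t i q' t' i' where x_eq: "x = ((q, t), i)" "x' = ((q', t'), i')" by (metis surj_pair)
    have qt: "(q, t) \<in> good_pairs a b X" "i \<in> {0..<int h}"
      and qt': "(q', t') \<in> good_pairs a b X" "i' \<in> {0..<int h}"
      using x by (auto simp: x_eq)
    have eq: "\<phi> ((q, t), i) = \<phi> ((q', t'), i')" using eqx by (simp only: x_eq)
    have q: "q \<in> {1..int X}" "t \<in> {0..<q}" "coprime (a * t + b) q"
      and q': "q' \<in> {1..int X}" "t' \<in> {0..<q'}" "coprime (a * t' + b) q'"
      using qt qt' by (auto simp: good_pairs_def)
    define z z' where "z = z0 (q, t) + i" and "z' = z0 (q', t') + i'"
    have "int p dvd z - z'" using eq by (simp add: \<phi>_def z_def z'_def mod_eq_dvd_iff)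
    then obtain m where m: "z - z' = int p * m" by blast
    define \<tau> where "\<tau> = t' + m * q'"
    define \<iota> \<iota>' where "\<iota> = q * z - (N + int p * t)" and "\<iota>' = q' * z' - (N + int p * t')"
    have io: "0 < \<iota>" "\<iota> \<le> H" "0 < \<iota>'" "\<iota>' \<le> H"
      using range[OF q(1), of i t] range[OF q'(1), of i' t'] qt(2) qt'(2) unfolding \<iota>_def \<iota>'_def z_def z'_def by auto
    \<comment> \<open>\<open>\<Delta> = 0\<close> says that the fractions
      \<open>(a t + b) / q\<close> and \<open>(a \<tau> + b) / q'\<close> agree. By
      \<open>key\<close>, \<open>p * \<Delta>\<close> is a sum of two terms: the first is below
      \<open>p / 2\<close> in size by the bound on \<open>\<rho>\<close>, the second at most
      \<open>p / 2\<close> by \<open>small\<close>.\<close>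
    define \<Delta> where "\<Delta> = q' * (a * t + b) - q * (a * \<tau> + b)"
    have key: "int p * \<Delta> = (q - q') * \<rho> + a * (q * \<iota>' - q' * \<iota>)"
    proof -
      have z: "z = z' + int p * m" using m by simp
      show ?thesis unfolding \<Delta>_def \<rho>_def \<iota>_def \<iota>'_def \<tau>_def z by (simp add: algebra_simps)
    qed
    have qX: "0 < q" "q \<le> int X" "0 < q'" "q' \<le> int X" using q(1) q'(1) by auto
    have "\<bar>(q - q') * \<rho>\<bar> \<le> int X * \<bar>\<rho>\<bar>" unfolding abs_mult using qX by (intro mult_right_mono) auto
    then have b1: "2 * \<bar>(q - q') * \<rho>\<bar> < int p" using rho by linarith
    have "0 < q * \<iota>'" "q * \<iota>' \<le> int X * H" "0 < q' * \<iota>" "q' * \<iota> \<le> int X * H"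
      using qX io by (auto intro!: mult_mono)
    then have "\<bar>q * \<iota>' - q' * \<iota>\<bar> \<le> int X * H" by linarith
    then have "\<bar>a * (q * \<iota>' - q' * \<iota>)\<bar> \<le> int (2 * X) * (int X * H)"
      unfolding abs_mult using ab(2,3) by (intro mult_mono) auto
    also have "2 * \<dots> = int (8 * h * X ^ 3)" by (simp add: H_def power3_eq_cube algebra_simps)
    finally have b2: "2 * \<bar>a * (q * \<iota>' - q' * \<iota>)\<bar> \<le> int p" using small by linarith
    have "\<bar>int p * \<Delta>\<bar> < int p" unfolding key using b1 b2 by linarith
    then have "\<bar>\<Delta>\<bar> < 1" using p0 by (simp add: abs_mult)
    then have D0: "q' * (a * t + b) = q * (a * \<tau> + b)" unfolding \<Delta>_def by simp
    have cop: "coprime (a * \<tau> + b) q'"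
    proof -
      have "a * \<tau> + b = (a * t' + b) + (a * m) * q'" by (simp add: \<tau>_def algebra_simps)
      then show ?thesis using q'(3) by (metis coprime_iff_gcd_eq_1 gcd.commute gcd_add_mult add.commute)
    qed
    \<comment> \<open>Both fractions are in lowest terms, so their denominators agree. Then
      \<open>t\<close> and \<open>t'\<close> differ by a multiple of \<open>q\<close> and both lie
      in \<open>{0..<q}\<close>.\<close>
    have "q dvd q'" using D0 q(3) by (metis coprime_commute coprime_dvd_mult_left_iff dvd_triv_left)
    moreover have "q' dvd q" using D0 cop by (metis coprime_commute coprime_dvd_mult_left_iff dvd_triv_left)
    ultimately have qq: "q = q'" using qX by (simp add: zdvd_antisym_nonneg)
    then have "a * t = a * \<tau>" using D0 qX by simp
    then have "t = t' + m * q" using ab(2) qq by (simp add: \<tau>_def)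
    moreover have "m = 0"
    proof -
      have "t div q = (t' + m * q) div q" using \<open>t = t' + m * q\<close> by simp
      then show ?thesis using q(2) q'(2) qq qX by simp
    qed
    ultimately have "t = t'" by simp
    moreover have "z = z'" using m \<open>m = 0\<close> by simp
    ultimately show "x = x'" using qq unfolding z_def z'_def by (simp add: x_eq)
  qed
  then have "card (good_pairs a b X \<times> {0..<int h}) \<le> card {z\<in>{0..<int p}. const_run \<chi> h z}"
  proof (rule card_inj_on_le)
    show "\<phi> ` (good_pairs a b X \<times> {0..<int h}) \<subseteq> {z\<in>{0..<int p}. const_run \<chi> h z}"
      using run p0 by (auto simp: \<phi>_def good_pairs_def)
    show "finite {z\<in>{0..<int p}. const_run \<chi> h z}" by (rule finite_subset[of _ "{0..<int p}"]) auto
  qed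
  then have "h * card (good_pairs a b X) \<le> card {z\<in>{0..<int p}. const_run \<chi> h z}"
    by (simp add: card_cartesian_product mult.commute)
  then show thesis using ab(1) that coprime_commute by blast
qed

section \<open>Numerical estimates and conclusion\<close>

lemma const_C_ge: "const_C \<ge> 13 / 2"
proof -
  have e: "exp (1::real) \<ge> 27 / 10"
  proof -
    have "5837465777 / 2147483648 - inverse (2 ^ 32) \<le> exp (1::real)" using e_approx_32 by linarith
    moreover have "27 / 10 \<le> 5837465777 / 2147483648 - inverse (2 ^ 32 :: real)" by simp
    ultimately show ?thesis by linarith
  qed
  have s: "sqrt 6 \<ge> 61 / (25::real)" by (rule real_le_rsqrt) (simp add: power2_eq_square)
  have "13 / 2 \<le> 3 * (27 / 10) * (61 / 25) / (3::real)" by simp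
  also have "\<dots> \<le> pi * exp 1 * sqrt 6 / 3"
    using e s pi_gt3 by (intro divide_right_mono mult_mono) auto
  finally show ?thesis by (simp add: const_C_def)
qed

lemma f_fun_bounds:
  assumes "X \<ge> 10000"
  shows "0 < f_fun X" "f_fun X \<le> 1"
proof -
  let ?S = "ln X / (2 * X) + 1 / X + 1 / (2 * X\<^sup>2)"
  have X: "X > 0" using assms by simp
  have nn: "?S \<ge> 0" using assms by (intro add_nonneg_nonneg) auto
  then show "f_fun X \<le> 1" unfolding f_fun_def by simp
  \<comment> \<open>Through \<open>ln X = 2 * ln (sqrt X) \<le> 2 * sqrt X\<close> the logarithmic
    term is at most \<open>1 / sqrt X\<close>.\<close>
  define r where "r = sqrt X"
  have r: "r \<ge> 100" "r * r = X" unfolding r_def using assms by (auto intro!: real_le_rsqrt)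
  have "ln X = 2 * ln r" using X by (simp add: r_def ln_sqrt)
  also have "\<dots> \<le> 2 * r" using ln_le_minus_one[of r] r by simp
  finally have "ln X / (2 * X) \<le> (2 * r) / (2 * X)" using X by (intro divide_right_mono) auto
  also have "\<dots> = 1 / r" using r by (simp add: field_simps flip: r(2))
  also have "\<dots> \<le> 1 / 100" using r by (intro divide_left_mono) auto
  finally have 1: "ln X / (2 * X) \<le> 1 / 100" .
  have 2: "1 / X \<le> 1 / 10000" using assms by (intro divide_left_mono) auto
  have "1 / (2 * X\<^sup>2) \<le> 1 / X" using assms by (simp add: field_simps power2_eq_square)
  then have S: "?S \<le> 1 / 50" using 1 2 by linarith
  have "pi\<^sup>2 / 3 \<le> 16 / 3" using pi_less_4 pi_gt_zero power_mono[of pi 4 2] by simp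
  then have "pi\<^sup>2 / 3 * ?S \<le> 16 / 3 * (1 / 50)" using S nn by (intro mult_mono) auto
  then show "0 < f_fun X" unfolding f_fun_def by linarith
qed

text \<open>\<open>f_fun\<close> takes a value in \<open>(0, 1]\<close> here, so both factors under
  the root are at least 1. Together with \<open>const_C_ge\<close>, a violated bound then forces
  \<open>H \<ge> 13/2 * p^(1/4) * ln p\<close>.\<close>

lemma g_fun_ge_1:
  assumes "real p powr (1/4) \<ge> 47000" "ln (real p) > 0"
  shows "g_fun p \<ge> 1"
proof -
  define X where "X = const_C * real p powr (1/4) / (2 * (exp 1)\<^sup>2)"
  have "(exp 1 :: real)\<^sup>2 \<le> (272 / 100)\<^sup>2" using e_less_272 by (intro power_mono) auto
  then have e: "2 * (exp 1 :: real)\<^sup>2 \<le> 15" by (simp add: power2_eq_square)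
  have "10000 \<le> (13 / 2 * 47000) / (15::real)" by simp
  also have "\<dots> \<le> X" unfolding X_def using const_C_ge assms(1) e by (intro frac_le mult_mono) auto
  finally have f: "0 < f_fun X" "f_fun X \<le> 1" using f_fun_bounds by blast+
  have "1 * 1 \<le> inverse (f_fun X) * (1 + 1 / ln (real p))"
    using f assms(2) one_le_inverse_iff[of "f_fun X"] by (intro mult_mono) auto
  then show ?thesis unfolding g_fun_def X_def[symmetric] by simp
qed

theorem corollary4p3:
  fixes p :: nat and \<chi> :: "int \<Rightarrow> complex" and N H :: int
  assumes "prime p"
    and "p \<ge> 5 * 10 ^ 18"
    and "dirichlet_character p \<chi>"
    and "\<chi> \<noteq> principal_character p"
    and "H \<ge> 1"
    and "constant_on_interval \<chi> N H"
  shows "real_of_int H < const_C * g_fun p * real p powr (1/4) * ln (real p)"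
proof (rule ccontr)
  assume "\<not> ?thesis"
  then have H: "const_C * g_fun p * real p powr (1/4) * ln (real p) \<le> real_of_int H" by simp
  define w where "w = real p powr (1/4)"
  define L where "L = ln (real p)"
  have "real (5 * 10 ^ 18) \<le> real p" using assms(2) by (simp only: of_nat_le_iff)
  then have p_ge: "real p \<ge> 5 * 10 ^ 18" by simp
  then have p_pos: "real p > 0" by simp
  have w4: "w ^ 4 = real p"
    unfolding w_def using p_pos by (simp add: powr_powr flip: powr_realpow)
  have w0: "w \<ge> 0" by (simp add: w_def)
  have w: "w \<ge> 47000"
  proof (rule ccontr)
    assume "\<not> w \<ge> 47000"
    then have "w ^ 4 \<le> 47000 ^ 4" using w0 by (intro power_mono) auto
    then show False unfolding w4 using p_ge by simp
  qed
  have Lw: "L = 4 * ln w" unfolding L_def w4[symmetric] using w by (simp add: ln_realpow)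
  have "ln (2 ^ 62) \<le> L" unfolding L_def using p_ge by (subst ln_le_cancel_iff) auto
  then have "62 * ln 2 \<le> L" using ln_realpow[of "2::real" 62] by (simp only: of_nat_numeral)
  then have L: "L \<ge> 41" using ln2_ge_two_thirds by linarith
  \<comment> \<open>The tangent of the logarithm at \<open>2 ^ 16\<close>, a power of two near the
    least possible \<open>w\<close>. The factor 416 obtained below is \<open>512 * 13 / 16\<close>,
    as \<open>512 * h \<le> w\<close> requires.\<close>
  have "ln w = ln (2 ^ 16) + ln (w / 2 ^ 16)" using w by (simp add: ln_div)
  also have "\<dots> \<le> 16 * (25 / 36) + (w / 2 ^ 16 - 1)"
    using w ln2_le_25_over_36 ln_realpow[of "2::real" 16] by (intro add_mono ln_le_minus_one) auto
  finally have Lle: "416 * L \<le> w" unfolding Lw using w by simp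
  \<comment> \<open>The least \<open>K\<close> with \<open>4 ^ K \<ge> p\<close>.\<close>
  define K where "K = nat \<lceil>L / (2 * ln 2)\<rceil>"
  have ratio: "L / (2 * ln 2) \<le> 3 / 4 * L" "L / (2 * ln 2) \<ge> 0"
    using L ln2_ge_two_thirds by (auto simp: field_simps)
  have K_ge: "L / (2 * ln 2) \<le> real K" unfolding K_def using ratio(2) by linarith
  have K_le: "real K \<le> 3 / 4 * L + 1" unfolding K_def using ratio by linarith
  have "16 * (real K + 1) \<le> 16 * (3 / 4 * L + 1 + 1)" using K_le by simp
  also have "\<dots> \<le> 13 * L" using L by simp
  finally have hL: "16 * (real K + 1) \<le> 13 * L" .
  have "L \<le> real K * (2 * ln 2)" using K_ge by (simp add: field_simps)
  also have "\<dots> = ln (4 ^ K)" using ln_realpow[of "2::real" "2 * K"] by (simp add: power_mult)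
  finally have "real p \<le> 4 ^ K" unfolding L_def using p_pos by simp
  then have p4K: "p \<le> 4 ^ K" by (metis of_nat_le_iff of_nat_numeral of_nat_power)
  have K3: "K \<ge> 3"
  proof (rule ccontr)
    assume "\<not> K \<ge> 3"
    then have "(4::nat) ^ K \<le> 4 ^ 3" by (intro power_increasing) auto
    then show False using p4K assms(2) by simp
  qed
  have "real (12 * K) ^ 4 \<le> w ^ 4" using hL Lle L by (intro power_mono) auto
  then have "real ((12 * K) ^ 4) \<le> real p" unfolding w4 by simp
  then have K12: "(12 * K) ^ 4 \<le> p" by (simp only: of_nat_le_iff)
  define h where "h = Suc K"
  \<comment> \<open>With \<open>X\<close> near \<open>4 * w\<close>, the condition
    \<open>8 * h * X ^ 3 \<le> p\<close> becomes \<open>512 * h \<le> w\<close>, and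
    \<open>2 * h * X \<le> H\<close> follows from \<open>16 * (K + 1) \<le> 13 * L\<close> and the
    lower bound \<open>13/2\<close> for \<open>const_C\<close>.\<close>
  define X where "X = nat \<lfloor>4 * w\<rfloor>"
  have X: "real X \<le> 4 * w" "4 * w - 1 \<le> real X" unfolding X_def using w by linarith+
  have hw: "512 * real h \<le> w" using hL Lle unfolding h_def by simp
  have "real (8 * h * X ^ 3) = 8 * real h * real X ^ 3" by simp
  also have "\<dots> \<le> 8 * real h * (4 * w) ^ 3" using X by (intro mult_left_mono power_mono) auto
  also have "\<dots> = (512 * real h) * w ^ 3" by (simp add: power_mult_distrib)
  also have "\<dots> \<le> w * w ^ 3" using hw w0 by (intro mult_right_mono) auto
  also have "\<dots> = real p" unfolding w4[symmetric] by (simp add: power_numeral_reduce)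
  finally have small: "8 * h * X ^ 3 \<le> p" by (simp only: of_nat_le_iff)
  have "real (2 * h * X) = 2 * real h * real X" by simp
  also have "\<dots> \<le> 2 * real h * (4 * w)" using X by (intro mult_left_mono) auto
  also have "\<dots> = (8 * real h) * w" by simp
  also have "\<dots> \<le> (13 / 2 * L) * w" using hL w0 unfolding h_def by (intro mult_right_mono) auto
  also have "\<dots> = 13 / 2 * 1 * w * L" by simp
  also have "\<dots> \<le> const_C * g_fun p * w * L"
    using const_C_ge g_fun_ge_1[of p] w L unfolding w_def L_def by (intro mult_mono) auto
  also have "\<dots> \<le> real_of_int H" using H unfolding w_def L_def .
  finally have hX: "int (2 * h * X) \<le> H" by linarith
  obtain c where "\<forall>n\<in>{N<..N+H}. \<chi> n = c" using assms(6) by (auto simp: constant_on_interval_def)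
  then have const: "\<chi> n = c" if "N < n" "n \<le> N + int (2 * h * X)" for n using that hX by auto
  have X_pos: "X > 0" and X_big: "X \<ge> 10000" using X(2) w by linarith+
  obtain a b where ab: "coprime a b"
    "h * card (good_pairs a b X) \<le> card {z\<in>{0..<int p}. const_run \<chi> h z}"
    using card_const_run_ge[OF assms(1,3) const _ X_pos small] h_def by blast
  obtain q s where qs: "p = q * s + 1" "q \<ge> 2" "\<And>a. \<chi> a = 1 \<Longrightarrow> int p dvd a ^ s - 1"
    using nonprincipal_character_kernel[OF assms(1,3,4)] by blast
  define D where "D = nat \<lfloor>w ^ 2\<rfloor>"
  have D: "real D \<le> w ^ 2" "w ^ 2 - 1 \<le> real D" unfolding D_def by simp_all
  have "real D * real D \<le> w ^ 2 * w ^ 2" using D(1) by (intro mult_mono) auto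
  also have "\<dots> = real p" unfolding w4[symmetric] by (simp flip: power_add)
  finally have DD: "D * D \<le> p" by (simp only: of_nat_le_iff flip: of_nat_mult)
  have "D * (h * card (good_pairs a b X)) \<le> 2 * p * K"
    using card_residue_set_bound[OF assms(1) qs(1,2) K3 p4K K12 DD]
      card_const_run_le[OF assms(1,3) qs(3), of K] ab(2) unfolding h_def
    by (meson le_trans mult_le_mono2)
  also have "\<dots> \<le> 2 * p * h" unfolding h_def by simp
  finally have "D * card (good_pairs a b X) * h \<le> 2 * p * h" by (simp add: mult_ac)
  \<comment> \<open>The \<open>h\<close> starting points in each window compensate the factor
    \<open>K < h\<close> in the upper bound.\<close>
  then have "D * card (good_pairs a b X) \<le> 2 * p" unfolding h_def by (simp only: mult_le_cancel2)
  then have "real (D * card (good_pairs a b X)) \<le> real (2 * p)" by (simp only: of_nat_le_iff)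
  then have "real D * real (card (good_pairs a b X)) \<le> 2 * w ^ 4" by (simp add: w4)
  \<comment> \<open>With \<open>D\<close> near \<open>w^2\<close> and \<open>X\<close> near
    \<open>4 * w\<close>, the product is about \<open>64/25 * w^4\<close>. The rounded constants
    still give \<open>54/25\<close>, which exceeds 2.\<close>
  moreover have "(9 / 10 * w ^ 2) * (12 / 5 * w ^ 2) \<le> real D * real (card (good_pairs a b X))"
  proof (rule mult_mono)
    have "47000 * 47000 \<le> w ^ 2" using w unfolding power2_eq_square by (intro mult_mono) auto
    then show "9 / 10 * w ^ 2 \<le> real D" using D(2) by linarith
    have "(39 / 10 * w) ^ 2 \<le> real X ^ 2" using X(2) w by (intro power_mono) linarith+
    moreover have "(39 / 10 * w) ^ 2 = 1521 / 100 * w ^ 2" by (simp add: power2_eq_square)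
    ultimately have "12 / 5 * w ^ 2 \<le> 4 / 25 * real X ^ 2" using zero_le_power2[of w] by linarith
    also have "\<dots> \<le> real (card (good_pairs a b X))" by (rule card_good_pairs_ge[OF ab(1) X_big])
    finally show "12 / 5 * w ^ 2 \<le> real (card (good_pairs a b X))" .
  qed auto
  moreover have "(9 / 10 * w ^ 2) * (12 / 5 * w ^ 2) = 54 / 25 * w ^ 4" by (simp flip: power_add)
  ultimately have "54 / 25 * w ^ 4 \<le> 2 * w ^ 4" by linarith
  then show False unfolding w4 using p_pos by simp
qed

end
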